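(* Let $m-n=2$ and let $\gamma_1,\ldots,\gamma_m\in\mathbb R^2$, $\delta\in\mathbb R^2$ satisfy the conditions below with $\mathcal R$ compact, and suppose that the associated map $i\colon N\to\mathbb C^m$ is an embedding (of an $H$-minimal Lagrangian submanifold). Then $N$ is diffeomorphic to some $N_k(p,q)$ with $p+q=m$, $0<p<m$ and $0\le k\le p$. Moreover, any such triple $(k,p,q)$ can be realised by such an $N$.
   Context: For $\gamma_1,\ldots,\gamma_m\in\mathbb R^{m-n}$ ($\gamma_{jk}$ = $j$th coordinate) and $\delta\in\mathbb R^{m-n}$ assume: (i) $\delta\in\mathbb R_\ge\langle\gamma_1,\ldots,\gamma_m\rangle$; (ii) if $\delta\in\mathbb R_\ge\langle\gamma_{i_1},\ldots,\gamma_{i_k}\rangle$ then $k\ge m-n$; (iii) the $\gamma_k$ generate a lattice $L\cong\mathbb Z^{m-n}$. Set $\mathcal R=\{\mathbf u\in\mathbb R^m\colon\sum_k\gamma_{jk}u_k^2=\delta_j\ \forall j\}$, $T_\Gamma=\mathbb R^{m-n}/L^*$ acting on $\mathbb C^m$ by $\varphi\cdot\mathbf z=(e^{2\pi i\langle\gamma_k,\varphi\rangle}z_k)_k$, $D_\Gamma=\tfrac12L^*/L^*$, $N=\mathcal R\times_{D_\Gamma}T_\Gamma$ (quotient by the diagonal action), $i[\mathbf u,\varphi]=\varphi\cdot\mathbf u$. $N_k(p,q)$ denotes the manifold $N$ obtained by this construction from the system of two quadrics in $\mathbb R^m$ ($m=p+q$): $u_1^2+\cdots+u_k^2+u_{k+1}^2+\cdots+u_p^2=1$,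 $u_1^2+\cdots+u_k^2+u_{p+1}^2+\cdots+u_m^2=2$ (here $L=\mathbb Z^2$); equivalently $N_k(p,q)\cong(S^{p-1}\times S^{q-1})\times_{\mathbb Z_2\times\mathbb Z_2}(S^1\times S^1)$, where the generators of $\mathbb Z_2\times\mathbb Z_2$ act on $S^1\times S^1=\mathbb R^2/\mathbb Z^2$ by translations by $(\tfrac12,0)$ and $(0,\tfrac12)$, and on the quadric by $\psi_1\colon(u_1,\ldots,u_m)\mapsto(-u_1,\ldots,-u_p,u_{p+1},\ldots,u_m)$ and $\psi_2\colon(u_1,\ldots,u_m)\mapsto(-u_1,\ldots,-u_k,u_{k+1},\ldots,u_p,-u_{p+1},\ldots,-u_m)$. *)

theory Defs
  imports "HOL-Analysis.Analysis"
begin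

fun Ck_on :: "nat \<Rightarrow> 'a::euclidean_space set \<Rightarrow> ('a \<Rightarrow> real) \<Rightarrow> bool" where
  "Ck_on 0 U f = continuous_on U f"
| "Ck_on (Suc n) U f =
     (\<exists>f'. (\<forall>x\<in>U. (f has_derivative f' x) (at x)) \<and> (\<forall>b\<in>Basis. Ck_on n U (\<lambda>x. f' x b)))"

definition Cinf_on :: "'a::euclidean_space set \<Rightarrow> ('a \<Rightarrow> real) \<Rightarrow> bool" where
  "Cinf_on U f \<longleftrightarrow> (\<forall>n. Ck_on n U f)"

definition smooth_on :: "'a::euclidean_space set \<Rightarrow> ('a \<Rightarrow> real) \<Rightarrow> bool" where
  "smooth_on S f \<longleftrightarrow>
     (\<forall>x\<in>S. \<exists>U g. open U \<and> x \<in> U \<and> Cinf_on U g \<and> (\<forall>y\<in>S \<inter> U. g y = f y))"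

definition smooth_map_on :: "'a::euclidean_space set \<Rightarrow> ('a \<Rightarrow> 'b::euclidean_space) \<Rightarrow> bool" where
  "smooth_map_on S F \<longleftrightarrow> (\<forall>b\<in>Basis. smooth_on S (\<lambda>x. F x \<bullet> b))"

definition cone_gen :: "('m \<Rightarrow> real^2) \<Rightarrow> 'm set \<Rightarrow> (real^2) set" where
  "cone_gen \<gamma> I = {(\<Sum>k\<in>I. a k *\<^sub>R \<gamma> k) | a. \<forall>k\<in>I. a k \<ge> 0}"

definition int_lattice :: "('m::finite \<Rightarrow> real^2) \<Rightarrow> (real^2) set" where
  "int_lattice \<gamma> = {(\<Sum>k\<in>UNIV. c k *\<^sub>R \<gamma> k) | c. \<forall>k. c k \<in> \<int>}"

definition quad_conditions :: "('m::finite \<Rightarrow> real^2) \<Rightarrow> real^2 \<Rightarrow> bool" where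
  "quad_conditions \<gamma> \<delta> \<longleftrightarrow>
     \<delta> \<in> cone_gen \<gamma> UNIV \<and>
     (\<forall>I. \<delta> \<in> cone_gen \<gamma> I \<longrightarrow> card I \<ge> 2) \<and>
     (\<exists>b1 b2. b1 \<noteq> b2 \<and> independent {b1, b2} \<and>
        int_lattice \<gamma> = {a *\<^sub>R b1 + c *\<^sub>R b2 | a c. a \<in> \<int> \<and> c \<in> \<int>})"

definition Rset :: "('m::finite \<Rightarrow> real^2) \<Rightarrow> real^2 \<Rightarrow> (real^'m) set" where
  "Rset \<gamma> \<delta> = {u. \<forall>j. (\<Sum>k\<in>UNIV. (\<gamma> k $ j) * (u $ k)^2) = \<delta> $ j}"

definition Lstar :: "('m::finite \<Rightarrow> real^2) \<Rightarrow> (real^2) set" where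
  "Lstar \<gamma> = {l. \<forall>k. \<gamma> k \<bullet> l \<in> \<int>}"

text \<open>The covering space M = R x R^2 (R^2 covering T_Gamma = R^2/L^*).\<close>
definition Mset :: "('m::finite \<Rightarrow> real^2) \<Rightarrow> real^2 \<Rightarrow> ((real^'m) \<times> (real^2)) set" where
  "Mset \<gamma> \<delta> = Rset \<gamma> \<delta> \<times> UNIV"

text \<open>N = R x_{D_Gamma} T_Gamma is M modulo the group (1/2) L^*, where l/2 acts by
  u_k |-> e^{2 pi i <gamma_k, l/2>} u_k = cos(pi <gamma_k,l>) u_k and phi |-> phi + l/2.
  (Elements of L^* = 2 (1/2 L^*) act trivially on R, giving T_Gamma.)\<close>
definition N_rel :: "('m::finite \<Rightarrow> real^2) \<Rightarrow> ((real^'m) \<times> (real^2)) \<Rightarrow> ((real^'m) \<times> (real^2)) \<Rightarrow> bool" where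
  "N_rel \<gamma> x y \<longleftrightarrow>
     (\<exists>l\<in>Lstar \<gamma>. snd y = snd x + (1/2) *\<^sub>R l \<and>
        (\<forall>k. fst y $ k = cos (pi * (\<gamma> k \<bullet> l)) * fst x $ k))"

definition N_invariant :: "('m::finite \<Rightarrow> real^2) \<Rightarrow> real^2 \<Rightarrow> ((real^'m) \<times> (real^2) \<Rightarrow> real) \<Rightarrow> bool" where
  "N_invariant \<gamma> \<delta> h \<longleftrightarrow>
     (\<forall>x\<in>Mset \<gamma> \<delta>. \<forall>y\<in>Mset \<gamma> \<delta>. N_rel \<gamma> x y \<longrightarrow> h x = h y)"

definition N_smooth_fun :: "('m::finite \<Rightarrow> real^2) \<Rightarrow> real^2 \<Rightarrow> ((real^'m) \<times> (real^2) \<Rightarrow> real) \<Rightarrow> bool" where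
  "N_smooth_fun \<gamma> \<delta> h \<longleftrightarrow> N_invariant \<gamma> \<delta> h \<and> smooth_on (Mset \<gamma> \<delta>) h"

text \<open>The map i[u,phi] = phi . u, lifted to M.\<close>
definition i_map :: "('m::finite \<Rightarrow> real^2) \<Rightarrow> ((real^'m) \<times> (real^2)) \<Rightarrow> complex^'m" where
  "i_map \<gamma> x = (\<chi> k. cis (2 * pi * (\<gamma> k \<bullet> snd x)) * complex_of_real (fst x $ k))"

text \<open>i : N -> C^m is a smooth embedding: it is smooth, injective on N, and a
  diffeomorphism onto its image i(N) with the structure induced from C^m, i.e. every
  smooth function on N is the pull-back of a smooth function on the subset i(N).\<close>
definition N_embedding :: "('m::finite \<Rightarrow> real^2) \<Rightarrow> real^2 \<Rightarrow> bool" where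
  "N_embedding \<gamma> \<delta> \<longleftrightarrow>
     smooth_map_on (Mset \<gamma> \<delta>) (i_map \<gamma>) \<and>
     (\<forall>x\<in>Mset \<gamma> \<delta>. \<forall>y\<in>Mset \<gamma> \<delta>. i_map \<gamma> x = i_map \<gamma> y \<longrightarrow> N_rel \<gamma> x y) \<and>
     (\<forall>h. N_smooth_fun \<gamma> \<delta> h \<longrightarrow>
        (\<exists>G. smooth_on (i_map \<gamma> ` Mset \<gamma> \<delta>) G \<and> (\<forall>x\<in>Mset \<gamma> \<delta>. h x = G (i_map \<gamma> x))))"

text \<open>N(gamma,delta) and N(gamma',delta') are diffeomorphic: there is a bijection
  between them (given by a map F of the covering spaces) which pulls back smooth
  functions to smooth functions and whose inverse does so too.\<close>
definition N_diffeomorphic ::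
  "('m::finite \<Rightarrow> real^2) \<Rightarrow> real^2 \<Rightarrow> ('m \<Rightarrow> real^2) \<Rightarrow> real^2 \<Rightarrow> bool" where
  "N_diffeomorphic \<gamma> \<delta> \<gamma>' \<delta>' \<longleftrightarrow>
     (\<exists>F. (\<forall>x\<in>Mset \<gamma> \<delta>. F x \<in> Mset \<gamma>' \<delta>') \<and>
          (\<forall>x\<in>Mset \<gamma> \<delta>. \<forall>y\<in>Mset \<gamma> \<delta>. N_rel \<gamma> x y \<longleftrightarrow> N_rel \<gamma>' (F x) (F y)) \<and>
          (\<forall>y\<in>Mset \<gamma>' \<delta>'. \<exists>x\<in>Mset \<gamma> \<delta>. N_rel \<gamma>' (F x) y) \<and>
          (\<forall>h. N_invariant \<gamma>' \<delta>' h \<longrightarrow>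
               (smooth_on (Mset \<gamma>' \<delta>') h \<longleftrightarrow> smooth_on (Mset \<gamma> \<delta>) (h \<circ> F))))"

text \<open>Coordinates are split into groups A = {1..k}, B = {k+1..p}, C = {p+1..m}.
  Quadrics: sum_{A u B} u^2 = 1, sum_{A u C} u^2 = 2.\<close>
definition Nk_gamma :: "'m set \<Rightarrow> 'm set \<Rightarrow> 'm set \<Rightarrow> 'm \<Rightarrow> real^2" where
  "Nk_gamma A B C k =
     (if k \<in> A then vector [1, 1] else if k \<in> B then vector [1, 0] else vector [0, 1])"

definition Nk_delta :: "real^2" where
  "Nk_delta = vector [1, 2]"

text \<open>N(gamma,delta) is diffeomorphic to N_k(p,q) (up to relabelling the coordinates).\<close>
definition diffeomorphic_to_Nkpq ::
  "('m::finite \<Rightarrow> real^2) \<Rightarrow> real^2 \<Rightarrow> nat \<Rightarrow> nat \<Rightarrow> nat \<Rightarrow> bool" where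
  "diffeomorphic_to_Nkpq \<gamma> \<delta> k p q \<longleftrightarrow>
     (\<exists>A B C. A \<union> B \<union> C = UNIV \<and> A \<inter> B = {} \<and> A \<inter> C = {} \<and> B \<inter> C = {} \<and>
        card A = k \<and> card B = p - k \<and> card C = q \<and>
        N_diffeomorphic \<gamma> \<delta> (Nk_gamma A B C) Nk_delta)"

end

theory Submission
  imports Defs
begin

text \<open>Compactness makes all \<open>\<gamma> k\<close> lie in an open half plane, and the ray of \<open>\<delta>\<close> splits
  them into two nonempty groups. One vector from each group suffices to solve the quadrics, so
  injectivity of \<open>i\<close> forces every such pair to be a basis of the lattice. In a basis \<open>g, h\<close> of this
  kind the groups are \<open>g + b\<^sub>i h\<close> and \<open>h + a\<^sub>j g\<close> with \<open>1 - a\<^sub>j b\<^sub>i = 1\<close>; hence all \<open>a\<^sub>j\<close> vanish or all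
  \<open>b\<^sub>i\<close> vanish, say the former. Rescaling the second group of coordinates deforms the quadrics
  for \<open>b\<close> to those for any other integers, and the action of \<open>D\<^sub>\<Gamma>\<close> only depends on the parities
  of the \<open>b\<^sub>i\<close>, so these may be taken in \<open>{0, 1}\<close>.\<close>

section \<open>Smooth functions\<close>

text \<open>Smoothness here means local extendability to the ambient space of the cover
  \<open>Mset\<close>, and functions on the quotient are the invariant ones. A diffeomorphism is
  therefore given by an explicit map between the covers that matches the relations
  \<open>N_rel\<close> and has an explicit smooth inverse. All determinants of pairs agree because
  any pair has integral coordinates in terms of any other pair: the transition determinant and its
  reciprocal are both positive integers. Rescaling never degenerates because, for every \<gamma> k
  in the first group, \<delta> = d g + e h lies strictly inside the cone of \<gamma> k and h. This
  makes every e - b k d positive, and the squared length left for the second group of coordinates is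
  a weighted average of these numbers. For the realisation part, injectivity of i has to be
  complemented by smooth extension of functions from the image. This comes from local smooth
  sections of i, which recover \<phi> from the arguments of two nonzero coordinates, one in each
  group.\<close>

lemma Ck_on_SucI:
  assumes "\<And>x. x \<in> U \<Longrightarrow> (f has_derivative f' x) (at x)"
    and "\<And>b. b \<in> Basis \<Longrightarrow> Ck_on n U (\<lambda>x. f' x b)"
  shows "Ck_on (Suc n) U f"
  using assms by auto

lemma Ck_on_Suc_imp: "Ck_on (Suc n) U f \<Longrightarrow> Ck_on n U f"
proof (induction n arbitrary: f)
  case 0
  then show ?case
    by (auto intro!: continuous_at_imp_continuous_on dest: has_derivative_continuous)
next
  case (Suc n)
  obtain f' where f': "\<And>x. x \<in> U \<Longrightarrow> (f has_derivative f' x) (at x)"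
    "\<And>b. b \<in> Basis \<Longrightarrow> Ck_on (Suc n) U (\<lambda>x. f' x b)"
    using Suc.prems unfolding Ck_on.simps by blast
  show ?case
    by (rule Ck_on_SucI[OF f'(1)]) (use f'(2) Suc.IH in auto)
qed

lemma Ck_on_subset: "Ck_on n U f \<Longrightarrow> V \<subseteq> U \<Longrightarrow> Ck_on n V f"
proof (induction n arbitrary: f)
  case 0
  then show ?case by (auto intro: continuous_on_subset)
next
  case (Suc n)
  obtain f' where f': "\<And>x. x \<in> U \<Longrightarrow> (f has_derivative f' x) (at x)"
    "\<And>b. b \<in> Basis \<Longrightarrow> Ck_on n U (\<lambda>x. f' x b)"
    using Suc.prems(1) unfolding Ck_on.simps by blast
  show ?case
    by (rule Ck_on_SucI[of V f f']) (use f' Suc in auto)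
qed

lemma Ck_on_const: "Ck_on n U (\<lambda>x. c)"
proof (induction n arbitrary: c)
  case (Suc n)
  show ?case by (rule Ck_on_SucI[of U _ "\<lambda>x h. 0"]) (use Suc in auto)
qed auto

lemma Ck_on_bounded_linear:
  assumes "bounded_linear f" shows "Ck_on n U f"
proof (cases n)
  case 0
  then show ?thesis using assms by (auto intro: linear_continuous_on)
next
  case (Suc k)
  show ?thesis unfolding Suc
    by (rule Ck_on_SucI[of U _ "\<lambda>x. f"])
      (use assms Ck_on_const in \<open>auto intro: bounded_linear_imp_has_derivative\<close>)
qed

lemma Ck_on_add: "Ck_on n U f \<Longrightarrow> Ck_on n U g \<Longrightarrow> Ck_on n U (\<lambda>x. f x + g x)"
proof (induction n arbitrary: f g)
  case 0
  then show ?case by (auto intro: continuous_intros)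
next
  case (Suc n)
  obtain f' where f': "\<And>x. x \<in> U \<Longrightarrow> (f has_derivative f' x) (at x)"
    "\<And>b. b \<in> Basis \<Longrightarrow> Ck_on n U (\<lambda>x. f' x b)"
    using Suc.prems(1) unfolding Ck_on.simps by blast
  obtain g' where g': "\<And>x. x \<in> U \<Longrightarrow> (g has_derivative g' x) (at x)"
    "\<And>b. b \<in> Basis \<Longrightarrow> Ck_on n U (\<lambda>x. g' x b)"
    using Suc.prems(2) unfolding Ck_on.simps by blast
  show ?case
    by (rule Ck_on_SucI[of U _ "\<lambda>x h. f' x h + g' x h"])
      (use f' g' Suc.IH in \<open>auto intro: has_derivative_add\<close>)
qed

lemma Ck_on_mult: "Ck_on n U f \<Longrightarrow> Ck_on n U g \<Longrightarrow> Ck_on n U (\<lambda>x. f x * g x)"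
proof (induction n arbitrary: f g)
  case 0
  then show ?case by (auto intro: continuous_intros)
next
  case (Suc n)
  obtain f' where f': "\<And>x. x \<in> U \<Longrightarrow> (f has_derivative f' x) (at x)"
    "\<And>b. b \<in> Basis \<Longrightarrow> Ck_on n U (\<lambda>x. f' x b)"
    using Suc.prems(1) unfolding Ck_on.simps by blast
  obtain g' where g': "\<And>x. x \<in> U \<Longrightarrow> (g has_derivative g' x) (at x)"
    "\<And>b. b \<in> Basis \<Longrightarrow> Ck_on n U (\<lambda>x. g' x b)"
    using Suc.prems(2) unfolding Ck_on.simps by blast
  show ?case
    by (rule Ck_on_SucI[of U _ "\<lambda>x h. f x * g' x h + f' x h * g x"])
      (use f' g' Suc.IH Suc.prems[THEN Ck_on_Suc_imp] in
        \<open>auto intro!: has_derivative_mult Ck_on_add\<close>)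
qed

lemma Ck_on_sum: "(\<And>i. i \<in> I \<Longrightarrow> Ck_on n U (f i)) \<Longrightarrow> Ck_on n U (\<lambda>x. \<Sum>i\<in>I. f i x)"
  by (induction I rule: infinite_finite_induct) (auto intro: Ck_on_const Ck_on_add)

text \<open>By the chain rule, each partial derivative of the composite is a sum of products of
  partials of G with composites of partials of f. The induction runs over arbitrary f, so it covers
  the latter composites.\<close>

lemma Ck_on_compose:
  assumes "Ck_on n V f" "\<And>c. c \<in> Basis \<Longrightarrow> Ck_on n U (\<lambda>x. G x \<bullet> c)" "G ` U \<subseteq> V"
  shows "Ck_on n U (\<lambda>x. f (G x))"
  using assms
proof (induction n arbitrary: f)
  case 0
  then have "continuous_on U G"
    by (simp add: continuous_on_componentwise[of U G])
  with 0 show ?case by (auto intro: continuous_on_compose2)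
next
  case (Suc n)
  obtain f' where f': "\<And>y. y \<in> V \<Longrightarrow> (f has_derivative f' y) (at y)"
    "\<And>b. b \<in> Basis \<Longrightarrow> Ck_on n V (\<lambda>y. f' y b)"
    using Suc.prems(1) unfolding Ck_on.simps by blast
  have "\<forall>c\<in>Basis. \<exists>g'. (\<forall>x\<in>U. ((\<lambda>x. G x \<bullet> c) has_derivative g' x) (at x)) \<and>
      (\<forall>b\<in>Basis. Ck_on n U (\<lambda>x. g' x b))"
    using Suc.prems(2) unfolding Ck_on.simps by blast
  then obtain g' where g': "\<And>c x. c \<in> Basis \<Longrightarrow> x \<in> U \<Longrightarrow> ((\<lambda>x. G x \<bullet> c) has_derivative g' c x) (at x)"
    "\<And>c b. c \<in> Basis \<Longrightarrow> b \<in> Basis \<Longrightarrow> Ck_on n U (\<lambda>x. g' c x b)"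
    by (auto dest!: bchoice)
  have low: "Ck_on n U (\<lambda>x. f' (G x) c)" if "c \<in> Basis" for c
    using Suc.IH[OF f'(2)[OF that]] Suc.prems(2,3) Ck_on_Suc_imp by blast
  show ?case
  proof (rule Ck_on_SucI[of U _ "\<lambda>x h. \<Sum>c\<in>Basis. g' c x h * f' (G x) c"])
    fix x assume x: "x \<in> U"
    have "(G has_derivative (\<lambda>h. \<Sum>c\<in>Basis. g' c x h *\<^sub>R c)) (at x)"
      by (subst has_derivative_componentwise_within) (use g'(1) x in auto)
    moreover have d: "(f has_derivative f' (G x)) (at (G x))"
      using f' x Suc.prems(3) by auto
    ultimately have "((\<lambda>x. f (G x)) has_derivative (\<lambda>h. f' (G x) (\<Sum>c\<in>Basis. g' c x h *\<^sub>R c))) (at x)"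
      by (rule has_derivative_compose)
    moreover have "linear (f' (G x))" using d has_derivative_linear by blast
    ultimately show "((\<lambda>x. f (G x)) has_derivative (\<lambda>h. \<Sum>c\<in>Basis. g' c x h * f' (G x) c)) (at x)"
      by (simp add: linear_sum linear_scale)
  next
    fix b :: 'b assume "b \<in> Basis"
    then show "Ck_on n U (\<lambda>x. \<Sum>c\<in>Basis. g' c x b * f' (G x) c)"
      by (intro Ck_on_sum Ck_on_mult g'(2) low)
  qed
qed

section \<open>Differentiability of the elementary functions\<close>

lemma Ck_on_compose_real:
  "Ck_on n V f \<Longrightarrow> Ck_on n U g \<Longrightarrow> g ` U \<subseteq> V \<Longrightarrow> Ck_on n U (\<lambda>x. f (g x))" for f :: "real \<Rightarrow> real"
  by (rule Ck_on_compose) auto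

lemma Ck_on_Suc_real:
  fixes f f' :: "real \<Rightarrow> real"
  assumes "\<And>x. x \<in> U \<Longrightarrow> (f has_real_derivative f' x) (at x)" "Ck_on n U f'"
  shows "Ck_on (Suc n) U f"
  by (rule Ck_on_SucI[of U f "\<lambda>x h. f' x * h"])
    (use assms in \<open>auto simp: has_field_derivative_def\<close>)

text \<open>The derivative is a polynomial in \<open>inverse\<close> itself, so each level of the
  induction supplies the next.\<close>

lemma Ck_on_inverse: "Ck_on n (- {0}) (inverse :: real \<Rightarrow> real)"
proof (induction n)
  case 0
  then show ?case by (auto intro!: continuous_intros)
next
  case (Suc n)
  show ?case
  proof (rule Ck_on_Suc_real[of _ _ "\<lambda>x. (- 1) * (inverse x * inverse x)"])
    show "Ck_on n (- {0}) (\<lambda>x::real. (- 1) * (inverse x * inverse x))"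
      by (intro Ck_on_mult Ck_on_const Suc)
  qed (auto intro!: derivative_eq_intros)
qed

lemma Ck_on_sqrt: "Ck_on n {0<..} sqrt"
proof (induction n)
  case 0
  then show ?case by (auto intro!: continuous_intros)
next
  case (Suc n)
  show ?case
  proof (rule Ck_on_Suc_real[of _ _ "\<lambda>x. inverse (sqrt x) * (1 / 2)"])
    show "Ck_on n {0<..} (\<lambda>x. inverse (sqrt x) * (1 / 2))"
      by (intro Ck_on_mult Ck_on_const Ck_on_compose_real[OF Ck_on_inverse Suc]) auto
  qed (auto intro!: derivative_eq_intros simp: divide_simps)
qed

lemma Ck_on_arctan: "Ck_on n UNIV arctan"
proof (cases n)
  case 0
  then show ?thesis by (auto intro!: continuous_intros)
next
  case (Suc k)
  have nz: "1 + x * x \<noteq> 0" for x :: real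
    using zero_le_square[of x] by linarith
  have "Ck_on k UNIV (\<lambda>x::real. 1 + x * x)"
    by (intro Ck_on_add Ck_on_mult Ck_on_const Ck_on_bounded_linear bounded_linear_ident)
  then have "Ck_on k UNIV (\<lambda>x::real. inverse (1 + x * x))"
    by (rule Ck_on_compose_real[OF Ck_on_inverse]) (use nz in auto)
  then show ?thesis unfolding Suc
    by (rule Ck_on_Suc_real[rotated]) (auto intro!: derivative_eq_intros simp: power2_eq_square)
qed

text \<open>Each function is, up to sign, the derivative of the other, so the induction has to carry
  both.\<close>

lemma Ck_on_sin_cos: "Ck_on n UNIV (sin :: real \<Rightarrow> real) \<and> Ck_on n UNIV (cos :: real \<Rightarrow> real)"
proof (induction n)
  case 0
  then show ?case by (auto intro!: continuous_intros)
next
  case (Suc n)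
  have "Ck_on n UNIV (\<lambda>x::real. (- 1) * sin x)"
    using Suc by (intro Ck_on_mult Ck_on_const) auto
  then have "Ck_on (Suc n) UNIV (cos :: real \<Rightarrow> real)"
    by (rule Ck_on_Suc_real[rotated]) (auto intro!: derivative_eq_intros)
  moreover have "Ck_on (Suc n) UNIV (sin :: real \<Rightarrow> real)"
    by (rule Ck_on_Suc_real[of _ _ cos]) (use Suc in \<open>auto intro!: derivative_eq_intros\<close>)
  ultimately show ?case by blast
qed

section \<open>Infinitely differentiable functions on open sets\<close>

lemma Cinf_on_subset: "Cinf_on U f \<Longrightarrow> V \<subseteq> U \<Longrightarrow> Cinf_on V f"
  by (meson Cinf_on_def Ck_on_subset)

lemma Cinf_on_const: "Cinf_on U (\<lambda>x. c)"
  by (simp add: Cinf_on_def Ck_on_const)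

lemma Cinf_on_bounded_linear: "bounded_linear f \<Longrightarrow> Cinf_on U f"
  by (simp add: Cinf_on_def Ck_on_bounded_linear)

lemma Cinf_on_add: "Cinf_on U f \<Longrightarrow> Cinf_on U g \<Longrightarrow> Cinf_on U (\<lambda>x. f x + g x)"
  by (simp add: Cinf_on_def Ck_on_add)

lemma Cinf_on_mult: "Cinf_on U f \<Longrightarrow> Cinf_on U g \<Longrightarrow> Cinf_on U (\<lambda>x. f x * g x)"
  by (simp add: Cinf_on_def Ck_on_mult)

lemma Cinf_on_diff:
  assumes "Cinf_on U f" "Cinf_on U g" shows "Cinf_on U (\<lambda>x. f x - g x)"
  using Cinf_on_add[OF assms(1) Cinf_on_mult[OF Cinf_on_const[of U "- 1"] assms(2)]] by simp

lemma Cinf_on_power: "Cinf_on U f \<Longrightarrow> Cinf_on U (\<lambda>x. f x ^ n)"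
  by (induction n) (auto intro: Cinf_on_const Cinf_on_mult)

lemma Cinf_on_sum: "(\<And>i. i \<in> I \<Longrightarrow> Cinf_on U (f i)) \<Longrightarrow> Cinf_on U (\<lambda>x. \<Sum>i\<in>I. f i x)"
  by (simp add: Cinf_on_def Ck_on_sum)

lemma Cinf_on_compose:
  assumes "Cinf_on V f" "\<And>c. c \<in> Basis \<Longrightarrow> Cinf_on U (\<lambda>x. G x \<bullet> c)" "G ` U \<subseteq> V"
  shows "Cinf_on U (\<lambda>x. f (G x))"
  using assms by (auto simp: Cinf_on_def intro: Ck_on_compose[of _ V])

lemma Cinf_on_inverse: "Cinf_on U f \<Longrightarrow> (\<And>x. x \<in> U \<Longrightarrow> f x \<noteq> 0) \<Longrightarrow> Cinf_on U (\<lambda>x. inverse (f x))"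
  unfolding Cinf_on_def by (auto intro: Ck_on_compose_real[OF Ck_on_inverse])

lemma Cinf_on_divide:
  "Cinf_on U f \<Longrightarrow> Cinf_on U g \<Longrightarrow> (\<And>x. x \<in> U \<Longrightarrow> g x \<noteq> 0) \<Longrightarrow> Cinf_on U (\<lambda>x. f x / g x)"
  unfolding divide_inverse by (intro Cinf_on_mult Cinf_on_inverse)

lemma Cinf_on_sqrt: "Cinf_on U f \<Longrightarrow> (\<And>x. x \<in> U \<Longrightarrow> f x > 0) \<Longrightarrow> Cinf_on U (\<lambda>x. sqrt (f x))"
  unfolding Cinf_on_def by (auto intro: Ck_on_compose_real[OF Ck_on_sqrt])

lemma Cinf_on_arctan: "Cinf_on U f \<Longrightarrow> Cinf_on U (\<lambda>x. arctan (f x))"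
  unfolding Cinf_on_def by (auto intro: Ck_on_compose_real[OF Ck_on_arctan])

lemma Cinf_on_sin: "Cinf_on U f \<Longrightarrow> Cinf_on U (\<lambda>x. sin (f x))"
  unfolding Cinf_on_def by (auto intro: Ck_on_compose_real[OF conjunct1[OF Ck_on_sin_cos]])

lemma Cinf_on_cos: "Cinf_on U f \<Longrightarrow> Cinf_on U (\<lambda>x. cos (f x))"
  unfolding Cinf_on_def by (auto intro: Ck_on_compose_real[OF conjunct2[OF Ck_on_sin_cos]])

lemmas Cinf_intros = Cinf_on_const Cinf_on_add Cinf_on_mult Cinf_on_diff Cinf_on_power Cinf_on_sum
  Cinf_on_divide Cinf_on_sqrt Cinf_on_arctan Cinf_on_sin Cinf_on_cos

lemma Cinf_on_imp_continuous_on: "Cinf_on U f \<Longrightarrow> continuous_on U f"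
  by (metis Cinf_on_def Ck_on.simps(1))

section \<open>Smooth functions and maps on arbitrary subsets\<close>

lemma Cinf_on_imp_smooth_on: "Cinf_on U f \<Longrightarrow> open U \<Longrightarrow> S \<subseteq> U \<Longrightarrow> smooth_on S f"
  unfolding smooth_on_def by blast

lemma smooth_on_cong:
  assumes "smooth_on S f" "\<And>x. x \<in> S \<Longrightarrow> f x = g x" shows "smooth_on S g"
proof -
  have "(\<forall>y\<in>S \<inter> U. k y = f y) \<longleftrightarrow> (\<forall>y\<in>S \<inter> U. k y = g y)" for U k
    using assms(2) by auto
  with assms(1) show ?thesis by (simp add: smooth_on_def)
qed

text \<open>Allows smoothness on the image of i to be checked on neighbourhoods where i has a
  section.\<close>

lemma smooth_on_local:
  assumes "\<And>x. x \<in> S \<Longrightarrow> \<exists>V. open V \<and> x \<in> V \<and> smooth_on (S \<inter> V) f"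
  shows "smooth_on S f"
  unfolding smooth_on_def
proof
  fix x assume x: "x \<in> S"
  then obtain V where V: "open V" "x \<in> V" "smooth_on (S \<inter> V) f" using assms by blast
  have "x \<in> S \<inter> V" using x V by blast
  from bspec[OF V(3)[unfolded smooth_on_def] this]
  obtain U k where U: "open U" "x \<in> U" "Cinf_on U k" "\<forall>y\<in>S \<inter> V \<inter> U. k y = f y" by blast
  have "open (U \<inter> V)" "x \<in> U \<inter> V" "Cinf_on (U \<inter> V) k" "\<forall>y\<in>S \<inter> (U \<inter> V). k y = f y"
    using U V Cinf_on_subset[OF U(3), of "U \<inter> V"] by auto
  then show "\<exists>U g. open U \<and> x \<in> U \<and> Cinf_on U g \<and> (\<forall>y\<in>S \<inter> U. g y = f y)" by blast
qed

lemma smooth_on_subset: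
  assumes "smooth_on S f" "T \<subseteq> S" shows "smooth_on T f"
  unfolding smooth_on_def
proof
  fix x assume "x \<in> T"
  then have "x \<in> S" using assms(2) by blast
  from bspec[OF assms(1)[unfolded smooth_on_def] this]
  obtain U g where "open U" "x \<in> U" "Cinf_on U g" "\<forall>y\<in>S \<inter> U. g y = f y" by blast
  moreover from this(4) have "\<forall>y\<in>T \<inter> U. g y = f y" using assms(2) by blast
  ultimately show "\<exists>U g. open U \<and> x \<in> U \<and> Cinf_on U g \<and> (\<forall>y\<in>T \<inter> U. g y = f y)" by blast
qed

lemma smooth_map_on_subset: "smooth_map_on S F \<Longrightarrow> T \<subseteq> S \<Longrightarrow> smooth_map_on T F"
  unfolding smooth_map_on_def by (blast intro: smooth_on_subset)

text \<open>The components of F extend separately, each to its own neighbourhood of x; on the finite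
  intersection W they are reassembled into one extension G. Away from S the values of G may leave
  the domain V of the extension of h, so W is cut down to the preimage of V.\<close>

lemma smooth_on_compose:
  assumes h: "smooth_on T h" and F: "smooth_map_on S F" and FS: "F ` S \<subseteq> T"
  shows "smooth_on S (\<lambda>x. h (F x))"
  unfolding smooth_on_def
proof
  fix x assume x: "x \<in> S"
  then have "F x \<in> T" using FS by blast
  from bspec[OF h[unfolded smooth_on_def] this]
  obtain V g where V: "open V" "F x \<in> V" "Cinf_on V g" "\<And>y. y \<in> T \<inter> V \<Longrightarrow> g y = h y"
    by blast
  have "\<forall>b\<in>Basis. \<exists>U f. open U \<and> x \<in> U \<and> Cinf_on U f \<and> (\<forall>y\<in>S \<inter> U. f y = F y \<bullet> b)"
    using F x by (simp add: smooth_map_on_def smooth_on_def)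
  from bchoice[OF this] obtain U where
    "\<forall>b\<in>Basis. \<exists>f. open (U b) \<and> x \<in> U b \<and> Cinf_on (U b) f \<and> (\<forall>y\<in>S \<inter> U b. f y = F y \<bullet> b)"
    by blast
  from bchoice[OF this] obtain f where Uf:
    "\<And>b. b \<in> Basis \<Longrightarrow> open (U b) \<and> x \<in> U b \<and> Cinf_on (U b) (f b) \<and>
      (\<forall>y\<in>S \<inter> U b. f b y = F y \<bullet> b)"
    by blast
  then have U: "\<And>b. b \<in> Basis \<Longrightarrow> open (U b) \<and> x \<in> U b \<and> Cinf_on (U b) (f b)"
    and f: "\<And>b y. b \<in> Basis \<Longrightarrow> y \<in> S \<inter> U b \<Longrightarrow> f b y = F y \<bullet> b"
    by simp_all
  define W where "W = (\<Inter>b\<in>Basis. U b)"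
  define G where "G y = (\<Sum>b\<in>Basis. f b y *\<^sub>R b)" for y
  have oW: "open W" unfolding W_def using U by auto
  have cinf: "Cinf_on W (\<lambda>y. G y \<bullet> c)" if "c \<in> Basis" for c
  proof -
    have "Cinf_on W (f c)" using U[OF that] that by (auto simp: W_def intro: Cinf_on_subset)
    then show ?thesis using that by (simp add: G_def)
  qed
  have GF: "G y = F y" if "y \<in> S \<inter> W" for y
  proof -
    have "G y = (\<Sum>b\<in>Basis. (F y \<bullet> b) *\<^sub>R b)"
      unfolding G_def by (rule sum.cong) (use that f in \<open>auto simp: W_def\<close>)
    then show ?thesis by (simp add: euclidean_representation)
  qed
  have "continuous_on W G"
    by (simp add: continuous_on_componentwise[of W G] Cinf_on_imp_continuous_on cinf)
  then have o: "open (W \<inter> G -` V)"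
    using oW V(1) by (simp add: continuous_open_preimage)
  have "Cinf_on (W \<inter> G -` V) (\<lambda>y. g (G y))"
    by (rule Cinf_on_compose[OF V(3)]) (auto intro: Cinf_on_subset[OF cinf])
  moreover have "x \<in> W" using U by (auto simp: W_def)
  moreover have "g (G y) = h (F y)" if "y \<in> S \<inter> (W \<inter> G -` V)" for y
    using that GF[of y] V(4)[of "F y"] FS by auto
  ultimately show "\<exists>U g. open U \<and> x \<in> U \<and> Cinf_on U g \<and> (\<forall>y\<in>S \<inter> U. g y = h (F y))"
    using o GF[of x] V(2) x
    by (intro exI[of _ "W \<inter> G -` V"] exI[of _ "\<lambda>y. g (G y)"]) simp
qed

lemma Cinf_on_fst_nth: "Cinf_on U (\<lambda>x::(real^'m) \<times> (real^2). fst x $ k)"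
  by (intro Cinf_on_bounded_linear bounded_linear_compose[OF bounded_linear_vec_nth] bounded_linear_fst)

lemma Cinf_on_inner_snd: "Cinf_on U (\<lambda>x::(real^'m) \<times> (real^2). g \<bullet> snd x)"
  by (intro Cinf_on_bounded_linear bounded_linear_compose[OF bounded_linear_inner_right] bounded_linear_snd)

lemma smooth_map_on_prodI:
  fixes F :: "'a::euclidean_space \<Rightarrow> (real^'m) \<times> (real^2)"
  assumes "\<And>k. smooth_on S (\<lambda>x. fst (F x) $ k)" "\<And>j. smooth_on S (\<lambda>x. snd (F x) $ j)"
  shows "smooth_map_on S F"
  unfolding smooth_map_on_def
proof
  fix b :: "(real^'m) \<times> (real^2)" assume "b \<in> Basis"
  then consider i where "b = (axis i 1, 0)" | j where "b = (0, axis j 1)"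
    by (auto simp: Basis_prod_def Basis_vec_def)
  then show "smooth_on S (\<lambda>x. F x \<bullet> b)"
    by cases (use assms in \<open>auto simp: inner_prod_def inner_axis\<close>)
qed

lemma smooth_map_on_complex_vecI:
  fixes F :: "'a::euclidean_space \<Rightarrow> complex^'m"
  assumes "\<And>k. smooth_on S (\<lambda>x. Re (F x $ k))" "\<And>k. smooth_on S (\<lambda>x. Im (F x $ k))"
  shows "smooth_map_on S F"
  unfolding smooth_map_on_def
proof
  fix b :: "complex^'m" assume "b \<in> Basis"
  then consider i where "b = axis i 1" | i where "b = axis i \<i>"
    by (auto simp: Basis_vec_def Basis_complex_def)
  then show "smooth_on S (\<lambda>x. F x \<bullet> b)"
    by cases (use assms in \<open>auto simp: inner_axis inner_complex_def\<close>)
qed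

section \<open>Diffeomorphisms between split systems\<close>

definition det2 :: "real^2 \<Rightarrow> real^2 \<Rightarrow> real" where
  "det2 x y = x $ 1 * y $ 2 - x $ 2 * y $ 1"

text \<open>Cramer's rule for the vector whose inner products with g and h are a and b, that is, the
  vector with coordinates a, b in the basis dual to g, h.\<close>

definition dual2 :: "real^2 \<Rightarrow> real^2 \<Rightarrow> real \<Rightarrow> real \<Rightarrow> real^2" where
  "dual2 g h a b = vector [(a * h $ 2 - b * g $ 2) / det2 g h, (g $ 1 * b - h $ 1 * a) / det2 g h]"

lemma inner_vec2: "x \<bullet> y = x $ 1 * y $ 1 + x $ 2 * y $ 2" for x y :: "real^2"
  by (simp add: inner_vec_def sum_2)

lemma det2_simps [simp]:
  "det2 (x + y) z = det2 x z + det2 y z" "det2 z (x + y) = det2 z x + det2 z y"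
  "det2 (c *\<^sub>R x) z = c * det2 x z" "det2 z (c *\<^sub>R x) = c * det2 z x"
  "det2 x x = 0" "det2 0 x = 0" "det2 x 0 = 0"
  by (simp_all add: det2_def algebra_simps)

lemma det2_swap: "det2 y x = - det2 x y"
  by (simp add: det2_def)

lemma dual2_nth [simp]:
  "dual2 g h a b $ 1 = (a * h $ 2 - b * g $ 2) / det2 g h"
  "dual2 g h a b $ 2 = (g $ 1 * b - h $ 1 * a) / det2 g h"
  by (simp_all add: dual2_def)

lemma inner_dual2:
  assumes "det2 g h \<noteq> 0"
  shows "g \<bullet> dual2 g h a b = a" "h \<bullet> dual2 g h a b = b"
proof -
  have "g $ 1 * (a * h $ 2 - b * g $ 2) + g $ 2 * (g $ 1 * b - h $ 1 * a) = a * det2 g h"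
    "h $ 1 * (a * h $ 2 - b * g $ 2) + h $ 2 * (g $ 1 * b - h $ 1 * a) = b * det2 g h"
    by (simp_all add: det2_def algebra_simps)
  with assms show "g \<bullet> dual2 g h a b = a" "h \<bullet> dual2 g h a b = b"
    by (simp_all add: inner_vec2 flip: add_divide_distrib)
qed

lemma dual2_inner:
  assumes "det2 g h \<noteq> 0"
  shows "dual2 g h (g \<bullet> x) (h \<bullet> x) = x"
proof -
  have "(g \<bullet> x) * h $ 2 - (h \<bullet> x) * g $ 2 = x $ 1 * det2 g h"
    "g $ 1 * (h \<bullet> x) - h $ 1 * (g \<bullet> x) = x $ 2 * det2 g h"
    by (simp_all add: det2_def inner_vec2 algebra_simps)
  with assms show ?thesis by (simp add: vec_eq_iff forall_2)
qed

lemma dual2_add: "dual2 g h (a + a') (b + b') = dual2 g h a b + dual2 g h a' b'"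
proof -
  have "(a + a') * h $ 2 - (b + b') * g $ 2 = (a * h $ 2 - b * g $ 2) + (a' * h $ 2 - b' * g $ 2)"
    "g $ 1 * (b + b') - h $ 1 * (a + a') = (g $ 1 * b - h $ 1 * a) + (g $ 1 * b' - h $ 1 * a')"
    by (simp_all add: algebra_simps)
  then show ?thesis by (simp add: vec_eq_iff forall_2 add_divide_distrib)
qed

lemma dual2_scale: "dual2 g h (c * a) (c * b) = c *\<^sub>R dual2 g h a b"
proof -
  have "c * a * h $ 2 - c * b * g $ 2 = c * (a * h $ 2 - b * g $ 2)"
    "g $ 1 * (c * b) - h $ 1 * (c * a) = c * (g $ 1 * b - h $ 1 * a)"
    by (simp_all add: algebra_simps)
  then show ?thesis by (simp add: vec_eq_iff forall_2)
qed

lemma det2_expand: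
  assumes "det2 g h \<noteq> 0"
  shows "x = (det2 x h / det2 g h) *\<^sub>R g + (det2 g x / det2 g h) *\<^sub>R h"
proof -
  have "det2 x h * g $ 1 + det2 g x * h $ 1 = x $ 1 * det2 g h"
    "det2 x h * g $ 2 + det2 g x * h $ 2 = x $ 2 * det2 g h"
    by (simp_all add: det2_def algebra_simps)
  with assms show ?thesis by (simp add: vec_eq_iff forall_2 flip: add_divide_distrib)
qed

text \<open>The sum is an average of the numbers c k d with weights u k squared over d, which add up
  to 1; all these numbers are below e.\<close>

lemma weighted_sum_squares_less:
  fixes u :: "'m::finite \<Rightarrow> real"
  assumes "(\<Sum>k\<in>L. (u k)\<^sup>2) = d" "0 < d" "\<And>k. k \<in> L \<Longrightarrow> c k * d < e"
  shows "(\<Sum>k\<in>L. c k * (u k)\<^sup>2) < e"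
proof -
  have "\<exists>i\<in>L. u i \<noteq> 0"
  proof (rule ccontr)
    assume "\<not> (\<exists>i\<in>L. u i \<noteq> 0)"
    then have "(\<Sum>k\<in>L. (u k)\<^sup>2) = 0" by (intro sum.neutral) auto
    with assms(1,2) show False by simp
  qed
  then obtain i where i: "i \<in> L" "u i \<noteq> 0" by blast
  have "(\<Sum>k\<in>L. c k * (u k)\<^sup>2) < (\<Sum>k\<in>L. e / d * (u k)\<^sup>2)"
  proof (rule sum_strict_mono_ex1)
    show "\<forall>k\<in>L. c k * (u k)\<^sup>2 \<le> e / d * (u k)\<^sup>2"
      using assms(2,3) by (intro ballI mult_right_mono) (auto simp: field_simps less_imp_le)
    show "\<exists>k\<in>L. c k * (u k)\<^sup>2 < e / d * (u k)\<^sup>2"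
      using assms(2,3) i by (intro bexI[of _ i] mult_strict_right_mono) (auto simp: field_simps)
  qed auto
  also have "\<dots> = e / d * d" by (simp only: assms(1) sum_distrib_left[symmetric])
  also have "\<dots> = e" using assms(2) by simp
  finally show ?thesis .
qed

text \<open>The normal form in which the vectors outside \<open>L\<close> all equal h. Since
  \<delta> = d \<gamma> k + (e - b k d) h for k in \<open>L\<close>, the two inequalities say that
  \<delta> is interior to the cone of h and each such \<gamma> k. The sign of
  \<open>det2 g h\<close> is left open so that the two groups may be exchanged.\<close>

definition split_system ::
  "'m set \<Rightarrow> real^2 \<Rightarrow> real^2 \<Rightarrow> ('m \<Rightarrow> int) \<Rightarrow> real \<Rightarrow> real \<Rightarrow> ('m::finite \<Rightarrow> real^2) \<Rightarrow> real^2 \<Rightarrow> bool"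
  where "split_system L g h b d e \<gamma> \<delta> \<longleftrightarrow>
    L \<noteq> {} \<and> L \<noteq> UNIV \<and> det2 g h \<noteq> 0 \<and>
    (\<forall>k. \<gamma> k = (if k \<in> L then g + of_int (b k) *\<^sub>R h else h)) \<and>
    \<delta> = d *\<^sub>R g + e *\<^sub>R h \<and> 0 < d \<and> (\<forall>k\<in>L. of_int (b k) * d < e)"

text \<open>The vector equation is read off in the basis g, h: the coefficient of g gives the first
  equation, that of h the second.\<close>

lemma Rset_split_system:
  assumes "split_system L g h b d e \<gamma> \<delta>"
  shows "u \<in> Rset \<gamma> \<delta> \<longleftrightarrow> (\<Sum>k\<in>L. (u $ k)\<^sup>2) = d \<and>
    (\<Sum>k\<in>L. of_int (b k) * (u $ k)\<^sup>2) + (\<Sum>k\<in>-L. (u $ k)\<^sup>2) = e"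
proof -
  define s where "s = (\<Sum>k\<in>L. (u $ k)\<^sup>2)"
  define t where "t = (\<Sum>k\<in>L. of_int (b k) * (u $ k)\<^sup>2) + (\<Sum>k\<in>-L. (u $ k)\<^sup>2)"
  have D: "det2 g h \<noteq> 0" and \<gamma>: "\<And>k. \<gamma> k = (if k \<in> L then g + of_int (b k) *\<^sub>R h else h)"
    and \<delta>: "\<delta> = d *\<^sub>R g + e *\<^sub>R h"
    using assms by (auto simp: split_system_def)
  have "(\<Sum>k\<in>UNIV. \<gamma> k $ j * (u $ k)\<^sup>2) = s * g $ j + t * h $ j" for j
  proof -
    have "(\<Sum>k\<in>UNIV. \<gamma> k $ j * (u $ k)\<^sup>2) =
      (\<Sum>k\<in>L. \<gamma> k $ j * (u $ k)\<^sup>2) + (\<Sum>k\<in>-L. \<gamma> k $ j * (u $ k)\<^sup>2)"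
      by (subst sum.union_disjoint[symmetric]) (auto simp: Compl_partition)
    also have "\<dots> = s * g $ j + t * h $ j"
      unfolding s_def t_def
      by (simp add: \<gamma> algebra_simps sum.distrib sum_distrib_left)
    finally show ?thesis .
  qed
  then have "u \<in> Rset \<gamma> \<delta> \<longleftrightarrow> s *\<^sub>R g + t *\<^sub>R h = d *\<^sub>R g + e *\<^sub>R h"
    by (simp add: Rset_def \<delta> vec_eq_iff)
  also have "\<dots> \<longleftrightarrow> s = d \<and> t = e"
  proof
    assume eq: "s *\<^sub>R g + t *\<^sub>R h = d *\<^sub>R g + e *\<^sub>R h"
    have "det2 (s *\<^sub>R g + t *\<^sub>R h) h = det2 (d *\<^sub>R g + e *\<^sub>R h) h"
      "det2 g (s *\<^sub>R g + t *\<^sub>R h) = det2 g (d *\<^sub>R g + e *\<^sub>R h)"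
      by (simp_all only: eq)
    then show "s = d \<and> t = e" using D by simp
  qed simp
  finally show ?thesis by (simp add: s_def t_def)
qed

text \<open>The \<gamma> k generate the same lattice as g and h: h is one of them, and g is some
  \<gamma> i minus b i times h.\<close>

lemma Lstar_split_system:
  assumes "split_system L g h b d e \<gamma> \<delta>"
  shows "l \<in> Lstar \<gamma> \<longleftrightarrow> g \<bullet> l \<in> \<int> \<and> h \<bullet> l \<in> \<int>"
proof -
  have \<gamma>: "\<And>k. \<gamma> k = (if k \<in> L then g + of_int (b k) *\<^sub>R h else h)"
    using assms by (auto simp: split_system_def)
  obtain i j where ij: "i \<in> L" "j \<notin> L" using assms by (auto simp: split_system_def)
  show ?thesis
  proof
    assume l: "l \<in> Lstar \<gamma>"
    then have "\<gamma> i \<bullet> l \<in> \<int>" "\<gamma> j \<bullet> l \<in> \<int>" by (auto simp: Lstar_def)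
    then have 1: "g \<bullet> l + of_int (b i) * (h \<bullet> l) \<in> \<int>" "h \<bullet> l \<in> \<int>"
      using ij by (simp_all add: \<gamma> inner_add_left)
    then have "(g \<bullet> l + of_int (b i) * (h \<bullet> l)) - of_int (b i) * (h \<bullet> l) \<in> \<int>"
      by (intro Ints_diff Ints_mult) auto
    with 1 show "g \<bullet> l \<in> \<int> \<and> h \<bullet> l \<in> \<int>" by simp
  next
    assume "g \<bullet> l \<in> \<int> \<and> h \<bullet> l \<in> \<int>"
    then show "l \<in> Lstar \<gamma>" by (auto simp: Lstar_def \<gamma> inner_add_left)
  qed
qed

lemma sin_pi_eq_0_iff: "sin (pi * x) = 0 \<longleftrightarrow> x \<in> \<int>"
  by (auto simp: sin_zero_iff_int2 mult.commute[of pi] elim!: Ints_cases)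

text \<open>This is where only the parities of the coefficients matter: changing the integer
  coefficient by an even number changes the angle by a multiple of 2 pi.\<close>

lemma cos_pi_cong:
  assumes "x \<in> \<int>" "even (a - b)"
  shows "cos (pi * (y + of_int a * x)) = cos (pi * (y + of_int b * x))"
proof -
  obtain n where n: "x = of_int n" using assms(1) by (auto elim: Ints_cases)
  obtain c where c: "a = b + 2 * c" using assms(2) by (metis dvdE diff_eq_eq add.commute)
  have "pi * (y + of_int a * x) = pi * (y + of_int b * x) + 2 * pi * of_int (c * n)"
    by (simp add: n c algebra_simps)
  then show ?thesis by (simp only: cos_add cos_int_2pin sin_int_2pin)
qed

text \<open>On the quadric, the coordinates outside \<open>L\<close> have squared length
  \<open>e - (\<Sum>k\<in>L. b k * (u $ k)\<^sup>2)\<close>, which stays positive; rescaling them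
  moves one such quadric to another without changing the signs of coordinates.\<close>

definition rescale ::
  "'m set \<Rightarrow> ('m \<Rightarrow> int) \<Rightarrow> real \<Rightarrow> real \<Rightarrow> ('m \<Rightarrow> int) \<Rightarrow> real \<Rightarrow> real \<Rightarrow> real^'m \<Rightarrow> real^('m::finite)"
  where "rescale L b d e b' d' e' u = (\<chi> k. if k \<in> L then sqrt (d' / d) * u $ k
    else sqrt ((e' - (\<Sum>k\<in>L. of_int (b' k) * (d' / d) * (u $ k)\<^sup>2)) /
               (e - (\<Sum>k\<in>L. of_int (b k) * (u $ k)\<^sup>2))) * u $ k)"

text \<open>Both sums are averages in the sense of \<open>weighted_sum_squares_less\<close>. For the
  first, the factor d' / d is chosen so that multiplying the weight by d gives b' k d', which is
  below e'.\<close>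

lemma rescale_positive:
  assumes "split_system L g h b d e \<gamma> \<delta>" "split_system L g' h' b' d' e' \<gamma>' \<delta>'" "u \<in> Rset \<gamma> \<delta>"
  shows "(\<Sum>k\<in>L. of_int (b' k) * (d' / d) * (u $ k)\<^sup>2) < e'"
    "(\<Sum>k\<in>L. of_int (b k) * (u $ k)\<^sup>2) < e"
proof -
  have u: "(\<Sum>k\<in>L. (u $ k)\<^sup>2) = d" using Rset_split_system[OF assms(1)] assms(3) by blast
  have d: "0 < d" "\<And>k. k \<in> L \<Longrightarrow> of_int (b k) * d < e" "\<And>k. k \<in> L \<Longrightarrow> of_int (b' k) * d' < e'"
    using assms(1,2) by (auto simp: split_system_def)
  show "(\<Sum>k\<in>L. of_int (b' k) * (d' / d) * (u $ k)\<^sup>2) < e'"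
    by (rule weighted_sum_squares_less[OF u d(1)]) (use d in simp)
  show "(\<Sum>k\<in>L. of_int (b k) * (u $ k)\<^sup>2) < e"
    by (rule weighted_sum_squares_less[OF u d(1,2)])
qed

text \<open>On the source quadric the squares outside \<open>L\<close> sum to q, so the factor sqrt
  (p / q) makes them sum to p. This is what the second target equation leaves for them once the
  coordinates in \<open>L\<close> are scaled by sqrt (d' / d).\<close>

lemma rescale_in_Rset:
  assumes "split_system L g h b d e \<gamma> \<delta>" "split_system L g' h' b' d' e' \<gamma>' \<delta>'" "u \<in> Rset \<gamma> \<delta>"
  shows "rescale L b d e b' d' e' u \<in> Rset \<gamma>' \<delta>'"
proof -
  define p where "p = e' - (\<Sum>k\<in>L. of_int (b' k) * (d' / d) * (u $ k)\<^sup>2)"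
  define q where "q = e - (\<Sum>k\<in>L. of_int (b k) * (u $ k)\<^sup>2)"
  have pq: "p > 0" "q > 0" unfolding p_def q_def using rescale_positive[OF assms] by auto
  have d: "d > 0" "d' > 0" using assms(1,2) by (auto simp: split_system_def)
  have u: "(\<Sum>k\<in>L. (u $ k)\<^sup>2) = d" "(\<Sum>k\<in>-L. (u $ k)\<^sup>2) = q"
    using Rset_split_system[OF assms(1)] assms(3) by (auto simp: q_def)
  let ?v = "rescale L b d e b' d' e' u"
  have v: "(?v $ k)\<^sup>2 = (if k \<in> L then d' / d * (u $ k)\<^sup>2 else p / q * (u $ k)\<^sup>2)" for k
    using d pq by (simp add: rescale_def power_mult_distrib p_def q_def)
  have "(\<Sum>k\<in>L. (?v $ k)\<^sup>2) = (\<Sum>k\<in>L. d' / d * (u $ k)\<^sup>2)"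
    by (rule sum.cong) (simp_all add: v)
  then have 1: "(\<Sum>k\<in>L. (?v $ k)\<^sup>2) = d'" using u d by (simp only: sum_distrib_left[symmetric]) simp
  have "(\<Sum>k\<in>-L. (?v $ k)\<^sup>2) = (\<Sum>k\<in>-L. p / q * (u $ k)\<^sup>2)"
    by (rule sum.cong) (simp_all add: v)
  then have 2: "(\<Sum>k\<in>-L. (?v $ k)\<^sup>2) = p" using u pq by (simp only: sum_distrib_left[symmetric]) simp
  have "(\<Sum>k\<in>L. of_int (b' k) * (?v $ k)\<^sup>2) = e' - p"
    by (simp add: p_def v algebra_simps)
  with 1 2 show ?thesis by (simp add: Rset_split_system[OF assms(2)])
qed

text \<open>At the rescaled point the two sums in the return map evaluate to e - q and e' - p again,
  so the return map scales by the reciprocal factors sqrt (d / d') and sqrt (q / p).\<close>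

lemma rescale_rescale:
  assumes "split_system L g h b d e \<gamma> \<delta>" "split_system L g' h' b' d' e' \<gamma>' \<delta>'" "u \<in> Rset \<gamma> \<delta>"
  shows "rescale L b' d' e' b d e (rescale L b d e b' d' e' u) = u"
proof -
  define p where "p = e' - (\<Sum>k\<in>L. of_int (b' k) * (d' / d) * (u $ k)\<^sup>2)"
  define q where "q = e - (\<Sum>k\<in>L. of_int (b k) * (u $ k)\<^sup>2)"
  have pq: "p > 0" "q > 0" unfolding p_def q_def using rescale_positive[OF assms] by auto
  have d: "d > 0" "d' > 0" using assms(1,2) by (auto simp: split_system_def)
  let ?v = "rescale L b d e b' d' e' u"
  have v: "?v $ k = (if k \<in> L then sqrt (d' / d) * u $ k else sqrt (p / q) * u $ k)" for k
    by (simp add: rescale_def p_def q_def)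
  have "(\<Sum>k\<in>L. of_int (b k) * (d / d') * (?v $ k)\<^sup>2) = e - q"
    using d by (simp add: q_def v power_mult_distrib)
  moreover have "(\<Sum>k\<in>L. of_int (b' k) * (?v $ k)\<^sup>2) = e' - p"
    using d by (simp add: p_def v power_mult_distrib algebra_simps)
  moreover have "sqrt (d / d') * sqrt (d' / d) = 1" "sqrt (q / p) * sqrt (p / q) = 1"
    using d pq by (simp_all flip: real_sqrt_mult)
  then have "sqrt (d / d') * (sqrt (d' / d) * x) = x" "sqrt (q / p) * (sqrt (p / q) * x) = x" for x
    by (metis mult.assoc mult_1)+
  ultimately show ?thesis
    unfolding rescale_def[of L b' d' e' b d e] by (simp add: vec_eq_iff v)
qed

text \<open>The formula is smooth where p and q are positive; this is an open set containing the
  whole cover.\<close>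

lemma smooth_on_rescale:
  assumes "split_system L g h b d e \<gamma> \<delta>" "split_system L g' h' b' d' e' \<gamma>' \<delta>'"
  shows "smooth_on (Mset \<gamma> \<delta>) (\<lambda>x. rescale L b d e b' d' e' (fst x) $ k)"
proof -
  define p where "p x = e' - (\<Sum>k\<in>L. of_int (b' k) * (d' / d) * (fst x $ k)\<^sup>2)"
    for x :: "(real^'a) \<times> (real^2)"
  define q where "q x = e - (\<Sum>k\<in>L. of_int (b k) * (fst x $ k)\<^sup>2)" for x :: "(real^'a) \<times> (real^2)"
  define U where "U = {x. p x > 0} \<inter> {x. q x > 0}"
  have p: "Cinf_on V p" and q: "Cinf_on V q" for V
    unfolding p_def q_def by (intro Cinf_intros Cinf_on_fst_nth)+
  have "open U" unfolding U_def
    using p[THEN Cinf_on_imp_continuous_on] q[THEN Cinf_on_imp_continuous_on]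
    by (intro open_Int open_Collect_less continuous_on_const)
  moreover have "Mset \<gamma> \<delta> \<subseteq> U"
    using rescale_positive[OF assms] by (auto simp: Mset_def U_def p_def q_def)
  moreover have "Cinf_on U (\<lambda>x. if k \<in> L then sqrt (d' / d) * fst x $ k else sqrt (p x / q x) * fst x $ k)"
  proof (cases "k \<in> L")
    case True
    then show ?thesis by (auto intro!: Cinf_on_mult Cinf_on_const Cinf_on_fst_nth)
  next
    case False
    have "Cinf_on U (\<lambda>x. sqrt (p x / q x) * fst x $ k)"
      by (intro Cinf_on_mult Cinf_on_sqrt Cinf_on_divide Cinf_on_fst_nth p q) (auto simp: U_def)
    with False show ?thesis by simp
  qed
  ultimately have "smooth_on (Mset \<gamma> \<delta>)
      (\<lambda>x. if k \<in> L then sqrt (d' / d) * fst x $ k else sqrt (p x / q x) * fst x $ k)"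
    by (intro Cinf_on_imp_smooth_on)
  then show ?thesis unfolding rescale_def p_def q_def vec_lambda_beta .
qed

text \<open>The lift to the covers. On \<phi> it is the linear isomorphism that preserves the
  pairings with g, h and g', h'; it therefore also matches the dual lattices.\<close>

definition transport ::
  "'m set \<Rightarrow> real^2 \<Rightarrow> real^2 \<Rightarrow> ('m \<Rightarrow> int) \<Rightarrow> real \<Rightarrow> real \<Rightarrow>
   real^2 \<Rightarrow> real^2 \<Rightarrow> ('m \<Rightarrow> int) \<Rightarrow> real \<Rightarrow> real \<Rightarrow>
   (real^'m) \<times> (real^2) \<Rightarrow> (real^'m::finite) \<times> (real^2)"
  where "transport L g h b d e g' h' b' d' e' x =
    (rescale L b d e b' d' e' (fst x), dual2 g' h' (g \<bullet> snd x) (h \<bullet> snd x))"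

lemma transport_in_Mset:
  assumes "split_system L g h b d e \<gamma> \<delta>" "split_system L g' h' b' d' e' \<gamma>' \<delta>'" "x \<in> Mset \<gamma> \<delta>"
  shows "transport L g h b d e g' h' b' d' e' x \<in> Mset \<gamma>' \<delta>'"
  using rescale_in_Rset[OF assms(1,2)] assms(3) by (auto simp: Mset_def transport_def)

lemma transport_transport:
  assumes "split_system L g h b d e \<gamma> \<delta>" "split_system L g' h' b' d' e' \<gamma>' \<delta>'" "x \<in> Mset \<gamma> \<delta>"
  shows "transport L g' h' b' d' e' g h b d e (transport L g h b d e g' h' b' d' e' x) = x"
proof -
  have "det2 g h \<noteq> 0" "det2 g' h' \<noteq> 0" using assms(1,2) by (auto simp: split_system_def)
  then show ?thesis
    using rescale_rescale[OF assms(1,2)] assms(3)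
    by (auto simp: transport_def Mset_def inner_dual2 dual2_inner)
qed

lemma smooth_map_on_transport:
  assumes "split_system L g h b d e \<gamma> \<delta>" "split_system L g' h' b' d' e' \<gamma>' \<delta>'"
  shows "smooth_map_on (Mset \<gamma> \<delta>) (transport L g h b d e g' h' b' d' e')"
proof (rule smooth_map_on_prodI)
  fix k
  show "smooth_on (Mset \<gamma> \<delta>) (\<lambda>x. fst (transport L g h b d e g' h' b' d' e' x) $ k)"
    using smooth_on_rescale[OF assms] by (simp add: transport_def)
next
  fix j :: 2
  have D: "det2 g' h' \<noteq> 0" using assms(2) by (auto simp: split_system_def)
  have "Cinf_on UNIV (\<lambda>x. snd (transport L g h b d e g' h' b' d' e' x) $ j)"
    using exhaust_2[of j] D
    by (auto simp: transport_def intro!: Cinf_intros Cinf_on_inner_snd)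
  then show "smooth_on (Mset \<gamma> \<delta>) (\<lambda>x. snd (transport L g h b d e g' h' b' d' e' x) $ j)"
    by (rule Cinf_on_imp_smooth_on) auto
qed

text \<open>The half-lattice acts on coordinates by signs. Hence the scaling factors in
  \<open>rescale\<close>, which involve only squares, are constant on classes.\<close>

lemma N_rel_square:
  assumes "N_rel \<gamma> x y"
  shows "(fst y $ k)\<^sup>2 = (fst x $ k)\<^sup>2"
proof -
  obtain l where l: "l \<in> Lstar \<gamma>" "fst y $ k = cos (pi * (\<gamma> k \<bullet> l)) * fst x $ k"
    using assms by (auto simp: N_rel_def)
  have "\<gamma> k \<bullet> l \<in> \<int>" using l(1) by (auto simp: Lstar_def)
  then have "sin (pi * (\<gamma> k \<bullet> l)) = 0" by (simp add: sin_pi_eq_0_iff)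
  then have "(cos (pi * (\<gamma> k \<bullet> l)))\<^sup>2 = 1" by (simp add: cos_squared_eq)
  then show ?thesis by (simp add: l(2) power_mult_distrib)
qed

text \<open>A translation by half of l is carried to one by half of l', where l' has the same
  pairings with g', h' as l has with g, h. The sign on coordinate k is the same on both sides by
  parity, and \<open>rescale\<close> commutes with sign changes.\<close>

lemma N_rel_transport:
  assumes S: "split_system L g h b d e \<gamma> \<delta>" and S': "split_system L g' h' b' d' e' \<gamma>' \<delta>'"
    and par: "\<And>k. k \<in> L \<Longrightarrow> even (b k - b' k)" and xy: "N_rel \<gamma> x y"
  shows "N_rel \<gamma>' (transport L g h b d e g' h' b' d' e' x) (transport L g h b d e g' h' b' d' e' y)"
proof -
  obtain l where l: "l \<in> Lstar \<gamma>" "snd y = snd x + (1/2) *\<^sub>R l"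
    "\<And>k. fst y $ k = cos (pi * (\<gamma> k \<bullet> l)) * fst x $ k"
    using xy by (auto simp: N_rel_def)
  have gh: "g \<bullet> l \<in> \<int>" "h \<bullet> l \<in> \<int>" using l(1) Lstar_split_system[OF S] by auto
  have D: "det2 g' h' \<noteq> 0" using S' by (auto simp: split_system_def)
  have \<gamma>: "\<And>k. \<gamma> k = (if k \<in> L then g + of_int (b k) *\<^sub>R h else h)"
    "\<And>k. \<gamma>' k = (if k \<in> L then g' + of_int (b' k) *\<^sub>R h' else h')"
    using S S' by (auto simp: split_system_def)
  define l' where "l' = dual2 g' h' (g \<bullet> l) (h \<bullet> l)"
  have gh': "g' \<bullet> l' = g \<bullet> l" "h' \<bullet> l' = h \<bullet> l" using D by (simp_all add: l'_def inner_dual2)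
  then have l': "l' \<in> Lstar \<gamma>'" using gh Lstar_split_system[OF S'] by simp
  have cos_eq: "cos (pi * (\<gamma>' k \<bullet> l')) = cos (pi * (\<gamma> k \<bullet> l))" for k
    using cos_pi_cong[OF gh(2) par] by (auto simp: \<gamma> inner_add_left gh')
  note sq = N_rel_square[OF xy]
  show ?thesis
    unfolding N_rel_def
  proof (intro bexI[OF _ l'] conjI allI)
    show "snd (transport L g h b d e g' h' b' d' e' y) =
      snd (transport L g h b d e g' h' b' d' e' x) + (1/2) *\<^sub>R l'"
      by (simp add: transport_def l(2) l'_def inner_add_right dual2_add flip: dual2_scale)
    show "fst (transport L g h b d e g' h' b' d' e' y) $ k =
      cos (pi * (\<gamma>' k \<bullet> l')) * fst (transport L g h b d e g' h' b' d' e' x) $ k" for k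
      by (simp add: transport_def rescale_def cos_eq sq) (simp add: l(3))
  qed
qed

lemma N_rel_refl: "N_rel \<gamma> x x"
  unfolding N_rel_def by (rule bexI[of _ 0]) (auto simp: Lstar_def)

text \<open>The transports in the two directions are mutually inverse on the covers, and both are
  smooth and compatible with the relations; the hypotheses are symmetric in the two systems.\<close>

lemma N_diffeomorphic_split_system:
  assumes S: "split_system L g h b d e \<gamma> \<delta>" and S': "split_system L g' h' b' d' e' \<gamma>' \<delta>'"
    and par: "\<And>k. k \<in> L \<Longrightarrow> even (b k - b' k)"
  shows "N_diffeomorphic \<gamma> \<delta> \<gamma>' \<delta>'"
proof -
  let ?F = "transport L g h b d e g' h' b' d' e'" and ?G = "transport L g' h' b' d' e' g h b d e"
  have par': "\<And>k. k \<in> L \<Longrightarrow> even (b' k - b k)" using par by (simp add: even_diff_iff)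
  show ?thesis
    unfolding N_diffeomorphic_def
  proof (intro exI[of _ ?F] conjI ballI allI impI)
    fix x y assume x: "x \<in> Mset \<gamma> \<delta>" and y: "y \<in> Mset \<gamma> \<delta>"
    show "N_rel \<gamma> x y \<longleftrightarrow> N_rel \<gamma>' (?F x) (?F y)"
    proof
      assume "N_rel \<gamma> x y"
      then show "N_rel \<gamma>' (?F x) (?F y)" by (rule N_rel_transport[OF S S', rotated]) (rule par)
    next
      assume "N_rel \<gamma>' (?F x) (?F y)"
      then have "N_rel \<gamma> (?G (?F x)) (?G (?F y))"
        by (rule N_rel_transport[OF S' S, rotated]) (rule par')
      then show "N_rel \<gamma> x y"
        by (simp add: transport_transport[OF S S' x] transport_transport[OF S S' y])
    qed
  next
    fix y assume "y \<in> Mset \<gamma>' \<delta>'"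
    then show "\<exists>x\<in>Mset \<gamma> \<delta>. N_rel \<gamma>' (?F x) y"
      using transport_transport[OF S' S, of y] transport_in_Mset[OF S' S, of y] N_rel_refl
      by metis
  next
    fix h
    show "smooth_on (Mset \<gamma>' \<delta>') h \<longleftrightarrow> smooth_on (Mset \<gamma> \<delta>) (h \<circ> ?F)"
    proof
      assume "smooth_on (Mset \<gamma>' \<delta>') h"
      then show "smooth_on (Mset \<gamma> \<delta>) (h \<circ> ?F)"
        unfolding comp_def
        by (rule smooth_on_compose[OF _ smooth_map_on_transport[OF S S']])
          (use transport_in_Mset[OF S S'] in auto)
    next
      assume "smooth_on (Mset \<gamma> \<delta>) (h \<circ> ?F)"
      then have "smooth_on (Mset \<gamma>' \<delta>') (\<lambda>x. (h \<circ> ?F) (?G x))"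
        by (rule smooth_on_compose[OF _ smooth_map_on_transport[OF S' S]])
          (use transport_in_Mset[OF S' S] in auto)
      then show "smooth_on (Mset \<gamma>' \<delta>') h"
        by (rule smooth_on_cong) (use transport_transport[OF S' S] in simp)
    qed
  qed (rule transport_in_Mset[OF S S'])
qed

section \<open>Embedded systems\<close>

text \<open>The quadrics are linear in the squares, so points of the quadric are, up to signs, the
  non-negative representations of \<delta>.\<close>

lemma sqrt_coefficients_in_Rset:
  assumes "\<And>k. 0 \<le> c k" "(\<Sum>k\<in>UNIV. c k *\<^sub>R \<gamma> k) = \<delta>"
  shows "(\<chi> k. sqrt (c k)) \<in> Rset \<gamma> \<delta>"
  unfolding assms(2)[symmetric] Rset_def using assms(1) by (simp add: mult.commute)

text \<open>Adding a multiple of a non-negative relation to the squares of u stays on the quadric; a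
  nonzero c i would make coordinate i unbounded.\<close>

lemma compact_Rset_imp_pointed:
  fixes \<gamma> :: "'m::finite \<Rightarrow> real^2"
  assumes comp: "compact (Rset \<gamma> \<delta>)" and u: "u \<in> Rset \<gamma> \<delta>"
    and c: "\<And>k. 0 \<le> c k" "(\<Sum>k\<in>UNIV. c k *\<^sub>R \<gamma> k) = 0"
  shows "c i = 0"
proof (rule ccontr)
  assume "c i \<noteq> 0"
  then have ci: "c i > 0" using c(1)[of i] by simp
  obtain B where B: "\<And>v. v \<in> Rset \<gamma> \<delta> \<Longrightarrow> norm v \<le> B"
    using compact_imp_bounded[OF comp] by (auto simp: bounded_iff)
  \<comment> \<open>Chosen so that the new i-th square is at least B squared plus 1.\<close>
  define t where "t = (B\<^sup>2 + 1) / c i"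
  have t: "t \<ge> 0" using ci by (simp add: t_def)
  have "(\<Sum>k\<in>UNIV. ((u $ k)\<^sup>2 + t * c k) *\<^sub>R \<gamma> k) =
      (\<Sum>k\<in>UNIV. (u $ k)\<^sup>2 *\<^sub>R \<gamma> k) + t *\<^sub>R (\<Sum>k\<in>UNIV. c k *\<^sub>R \<gamma> k)"
    by (simp add: scaleR_add_left sum.distrib scaleR_sum_right)
  also have "\<dots> = \<delta>"
    using u by (simp add: c(2) Rset_def vec_eq_iff mult.commute)
  finally have "(\<chi> k. sqrt ((u $ k)\<^sup>2 + t * c k)) \<in> Rset \<gamma> \<delta>"
    using t c(1) by (intro sqrt_coefficients_in_Rset) auto
  from B[OF this] have "\<bar>sqrt ((u $ i)\<^sup>2 + t * c i)\<bar> \<le> B"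
    using component_le_norm_cart[of "\<chi> k. sqrt ((u $ k)\<^sup>2 + t * c k)" i] by simp
  then have "(sqrt ((u $ i)\<^sup>2 + t * c i))\<^sup>2 \<le> B\<^sup>2"
    by (metis abs_ge_zero power2_abs power_mono)
  then have "(u $ i)\<^sup>2 + t * c i \<le> B\<^sup>2"
    using t c(1)[of i] by simp
  moreover have "t * c i = B\<^sup>2 + 1" using ci by (simp add: t_def)
  ultimately show False using zero_le_power2[of "u $ i"] by linarith
qed

text \<open>Injectivity says that the vectors \<open>\<gamma> k\<close> on the support of a point of the
  quadric generate the same lattice as all of them; this is the dual formulation.\<close>

lemma N_embedding_imp_Lstar:
  assumes emb: "N_embedding \<gamma> \<delta>" and u: "u \<in> Rset \<gamma> \<delta>"
    and int: "\<And>k. u $ k \<noteq> 0 \<Longrightarrow> \<gamma> k \<bullet> \<psi> \<in> \<int>"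
  shows "\<psi> \<in> Lstar \<gamma>"
proof -
  \<comment> \<open>On the support of u the phase of half \<psi> is a sign, which v absorbs. So i
    agrees at (v, 0) and at (u, \<psi> / 2), and injectivity makes this translation by half \<psi>
    one by half an element of \<open>Lstar\<close>.\<close>
  define v where "v = (\<chi> k. cos (pi * (\<gamma> k \<bullet> \<psi>)) * u $ k)"
  have sin: "sin (pi * (\<gamma> k \<bullet> \<psi>)) = 0" if "u $ k \<noteq> 0" for k
    using int[OF that] by (simp add: sin_pi_eq_0_iff)
  have "(v $ k)\<^sup>2 = (u $ k)\<^sup>2" for k
    using sin[of k] by (cases "u $ k = 0") (auto simp: v_def power_mult_distrib cos_squared_eq)
  then have v: "v \<in> Rset \<gamma> \<delta>" using u by (simp add: Rset_def)
  have "i_map \<gamma> (v, 0) = i_map \<gamma> (u, (1/2) *\<^sub>R \<psi>)"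
  proof -
    have "complex_of_real (v $ k) = cis (pi * (\<gamma> k \<bullet> \<psi>)) * complex_of_real (u $ k)" for k
      using sin[of k] by (cases "u $ k = 0") (auto simp: v_def complex_eq_iff)
    then show ?thesis by (simp add: i_map_def vec_eq_iff)
  qed
  moreover have "(v, 0) \<in> Mset \<gamma> \<delta>" "(u, (1/2) *\<^sub>R \<psi>) \<in> Mset \<gamma> \<delta>"
    using u v by (auto simp: Mset_def)
  ultimately have "N_rel \<gamma> (v, 0) (u, (1/2) *\<^sub>R \<psi>)"
    using emb unfolding N_embedding_def by blast
  then show ?thesis by (auto simp: N_rel_def)
qed

lemma sum_scaleR_pair:
  fixes f :: "'m::finite \<Rightarrow> 'a::real_vector"
  assumes "i \<noteq> j"
  shows "(\<Sum>k\<in>UNIV. (if k = i then x else if k = j then y else 0) *\<^sub>R f k) = x *\<^sub>R f i + y *\<^sub>R f j"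
proof -
  have "(\<Sum>k\<in>UNIV. (if k = i then x else if k = j then y else 0) *\<^sub>R f k) =
    (\<Sum>k\<in>{i, j}. (if k = i then x else if k = j then y else 0) *\<^sub>R f k)"
    by (rule sum.mono_neutral_right) auto
  also have "\<dots> = x *\<^sub>R f i + y *\<^sub>R f j" using assms by simp
  finally show ?thesis .
qed

text \<open>Vectors on opposite sides of the ray of \<delta> have \<delta> in the interior of their
  cone, which yields a point of the quadric supported on these two coordinates. Injectivity at that
  point forces every \<gamma> k to have integral coordinates in \<gamma> i, \<gamma> j.\<close>

lemma two_sided_pair:
  fixes \<gamma> :: "'m::finite \<Rightarrow> real^2"
  assumes emb: "N_embedding \<gamma> \<delta>" and \<delta>: "\<delta> = (\<Sum>k\<in>UNIV. a k *\<^sub>R \<gamma> k)" "\<And>k. 0 \<le> a k"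
    and pointed: "\<forall>c. (\<forall>k. 0 \<le> c k) \<longrightarrow> (\<Sum>k\<in>UNIV. c k *\<^sub>R \<gamma> k) = 0 \<longrightarrow> (\<forall>k. c k = 0)"
    and i: "det2 (\<gamma> i) \<delta> > 0" and j: "det2 (\<gamma> j) \<delta> < 0"
  shows "det2 (\<gamma> i) (\<gamma> j) > 0"
    and "det2 (\<gamma> k) (\<gamma> j) / det2 (\<gamma> i) (\<gamma> j) \<in> \<int>"
    and "det2 (\<gamma> i) (\<gamma> k) / det2 (\<gamma> i) (\<gamma> j) \<in> \<int>"
proof -
  define D where "D = det2 (\<gamma> i) (\<gamma> j)"
  define \<alpha> where "\<alpha> = det2 \<delta> (\<gamma> j)"
  define \<beta> where "\<beta> = det2 (\<gamma> i) \<delta>"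
  have pos: "\<alpha> > 0" "\<beta> > 0" using i j by (simp_all add: \<alpha>_def \<beta>_def det2_swap[of "\<gamma> j"])
  have "i \<noteq> j" using i j by auto
  \<comment> \<open>Cramer's rule without division, so that it may be used before D is known to be
    nonzero.\<close>
  have rel: "D *\<^sub>R \<delta> = \<alpha> *\<^sub>R \<gamma> i + \<beta> *\<^sub>R \<gamma> j"
    by (simp add: vec_eq_iff forall_2 D_def \<alpha>_def \<beta>_def) (simp add: det2_def algebra_simps)
  note two = sum_scaleR_pair[OF \<open>i \<noteq> j\<close>, of _ _ \<gamma>]
  have D: "D > 0"
  proof (rule ccontr)
    assume "\<not> D > 0"
    \<comment> \<open>For D at most 0, moving D \<delta> to the other side and expanding \<delta>
      gives a non-negative relation whose coefficient at i is at least \<alpha>.\<close>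
    define c where "c k = (if k = i then \<alpha> else if k = j then \<beta> else 0) + (- D) * a k" for k
    have Da: "D * a k \<le> 0" for k using \<open>\<not> D > 0\<close> \<delta>(2)[of k] by (simp add: mult_nonpos_nonneg)
    have "c k \<ge> 0" for k
      using pos Da[of k] by (auto simp: c_def)
    moreover have "(\<Sum>k\<in>UNIV. c k *\<^sub>R \<gamma> k) = 0"
    proof -
      have "(\<Sum>k\<in>UNIV. c k *\<^sub>R \<gamma> k) = (\<alpha> *\<^sub>R \<gamma> i + \<beta> *\<^sub>R \<gamma> j) + (- D) *\<^sub>R \<delta>"
        unfolding c_def scaleR_add_left sum.distrib two \<delta>(1) scaleR_sum_right by simp
      then show ?thesis by (simp add: rel[symmetric])
    qed
    ultimately have "c i = 0" using pointed by blast
    moreover have "c i \<ge> \<alpha>" using \<open>\<not> D > 0\<close> \<delta>(2)[of i] by (simp add: c_def mult_nonpos_nonneg)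
    ultimately show False using pos by simp
  qed
  then show "det2 (\<gamma> i) (\<gamma> j) > 0" by (simp add: D_def)
  define c where "c k = (if k = i then \<alpha> / D else if k = j then \<beta> / D else 0)" for k
  have "(\<Sum>k\<in>UNIV. c k *\<^sub>R \<gamma> k) = (1 / D) *\<^sub>R (\<alpha> *\<^sub>R \<gamma> i + \<beta> *\<^sub>R \<gamma> j)"
    unfolding c_def two by (simp add: scaleR_add_right divide_inverse mult.commute)
  also have "\<dots> = \<delta>" using D by (simp add: rel[symmetric])
  finally have u: "(\<chi> k. sqrt (c k)) \<in> Rset \<gamma> \<delta>"
    using pos D by (intro sqrt_coefficients_in_Rset) (auto simp: c_def)
  \<comment> \<open>The basis dual to \<gamma> i, \<gamma> j pairs integrally with the two vectors
    on the support, hence lies in \<open>Lstar \<gamma>\<close>; pairing with it reads off the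
    coordinates of any \<gamma> k.\<close>
  have dual: "\<gamma> k \<bullet> dual2 (\<gamma> i) (\<gamma> j) x y \<in> \<int>" if "x \<in> \<int>" "y \<in> \<int>" for x y k
  proof -
    have "dual2 (\<gamma> i) (\<gamma> j) x y \<in> Lstar \<gamma>"
      by (rule N_embedding_imp_Lstar[OF emb u])
        (use D that in \<open>auto simp: c_def D_def inner_dual2 split: if_splits\<close>)
    then show ?thesis by (auto simp: Lstar_def)
  qed
  have inner: "\<gamma> k \<bullet> dual2 (\<gamma> i) (\<gamma> j) x y = det2 (\<gamma> k) (\<gamma> j) / D * x + det2 (\<gamma> i) (\<gamma> k) / D * y" for x y
    using D inner_dual2[of "\<gamma> i" "\<gamma> j" x y]
    by (subst det2_expand[of "\<gamma> i" "\<gamma> j" "\<gamma> k"]) (simp_all add: inner_add_left D_def)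
  show "det2 (\<gamma> k) (\<gamma> j) / det2 (\<gamma> i) (\<gamma> j) \<in> \<int>" "det2 (\<gamma> i) (\<gamma> k) / det2 (\<gamma> i) (\<gamma> j) \<in> \<int>"
    using dual[of 1 0 k] dual[of 0 1 k] by (simp_all add: inner D_def)
qed

lemma embedding_imp_split_system:
  fixes \<gamma> :: "'m::finite \<Rightarrow> real^2"
  assumes quad: "quad_conditions \<gamma> \<delta>" and comp: "compact (Rset \<gamma> \<delta>)" and emb: "N_embedding \<gamma> \<delta>"
  obtains L g h b d e where "split_system L g h b d e \<gamma> \<delta>"
proof -
  obtain a where a: "\<delta> = (\<Sum>k\<in>UNIV. a k *\<^sub>R \<gamma> k)" "\<And>k. 0 \<le> a k"
    using quad by (auto simp: quad_conditions_def cone_gen_def)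
  have card: "card I \<ge> 2" if "\<delta> \<in> cone_gen \<gamma> I" for I
    using that quad by (auto simp: quad_conditions_def)
  have pointed: "c k = 0" if "\<And>k. 0 \<le> c k" "(\<Sum>k\<in>UNIV. c k *\<^sub>R \<gamma> k) = 0" for c k
    using compact_Rset_imp_pointed[OF comp sqrt_coefficients_in_Rset[of a] that] a by simp
  have \<delta>0: "\<delta> \<noteq> 0"
  proof
    assume "\<delta> = 0"
    then have "\<delta> \<in> cone_gen \<gamma> {}" by (simp add: cone_gen_def)
    from card[OF this] show False by simp
  qed
  \<comment> \<open>A positive multiple of \<delta> among the \<gamma> k would put \<delta> into a
    cone with one generator. A multiple t at most 0 would give the non-negative relation \<gamma> k
    + (- t) \<delta> = 0, with \<delta> expanded.\<close>
  have det_nz: "det2 (\<gamma> k) \<delta> \<noteq> 0" for k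
  proof
    assume "det2 (\<gamma> k) \<delta> = 0"
    then obtain t where t: "\<gamma> k = t *\<^sub>R \<delta>"
    proof -
      have "\<delta> \<bullet> \<delta> \<noteq> 0" using \<delta>0 by simp
      moreover have "(\<delta> \<bullet> \<delta>) *\<^sub>R \<gamma> k = (\<gamma> k \<bullet> \<delta>) *\<^sub>R \<delta>"
        using \<open>det2 (\<gamma> k) \<delta> = 0\<close>
        by (simp add: vec_eq_iff forall_2 inner_vec2 det2_def) (algebra)
      ultimately have "\<gamma> k = ((\<gamma> k \<bullet> \<delta>) / (\<delta> \<bullet> \<delta>)) *\<^sub>R \<delta>"
        by (metis divide_inverse mult.commute scaleR_scaleR right_inverse scaleR_one)
      then show ?thesis by (rule that)
    qed
    show False
    proof (cases "t > 0")
      case True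
      then have "\<delta> = (\<Sum>i\<in>{k}. (1 / t) *\<^sub>R \<gamma> i)" by (simp add: t)
      then have "\<delta> \<in> cone_gen \<gamma> {k}"
        unfolding cone_gen_def using True by (intro CollectI exI[of _ "\<lambda>_. 1 / t"]) auto
      from card[OF this] show False by simp
    next
      case False
      define c where "c i = (if i = k then 1 else 0) + (- t) * a i" for i
      have ta: "t * a i \<le> 0" for i using False a(2)[of i] by (simp add: mult_nonpos_nonneg)
      have "c i \<ge> 0" for i
        using ta[of i] by (auto simp: c_def)
      moreover have "(\<Sum>i\<in>UNIV. c i *\<^sub>R \<gamma> i) = 0"
      proof -
        have "(\<Sum>i\<in>UNIV. (if i = k then 1 else 0) *\<^sub>R \<gamma> i) = (\<Sum>i\<in>UNIV. if i = k then \<gamma> i else 0)"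
          by (rule sum.cong) auto
        then have "(\<Sum>i\<in>UNIV. c i *\<^sub>R \<gamma> i) = \<gamma> k + (- t) *\<^sub>R \<delta>"
          unfolding c_def scaleR_add_left sum.distrib a(1) scaleR_sum_right by simp
        then show ?thesis by (simp add: t)
      qed
      ultimately have "c k = 0" by (rule pointed)
      moreover have "c k \<ge> 1" using False a(2)[of k] by (simp add: c_def mult_nonpos_nonneg)
      ultimately show False by simp
    qed
  qed
  define L where "L = {k. det2 (\<gamma> k) \<delta> > 0}"
  have L: "det2 (\<gamma> k) \<delta> > 0" if "k \<in> L" for k using that by (simp add: L_def)
  have C: "det2 (\<gamma> k) \<delta> < 0" if "k \<notin> L" for k using that det_nz[of k] by (simp add: L_def)
  \<comment> \<open>This is the determinant of \<delta> with itself. With some a k positive and no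
    determinant zero, both signs must occur, so neither group is empty.\<close>
  have sum0: "(\<Sum>k\<in>UNIV. a k * det2 (\<gamma> k) \<delta>) = 0"
  proof -
    have "det2 (\<Sum>k\<in>I. a k *\<^sub>R \<gamma> k) \<delta> = (\<Sum>k\<in>I. a k * det2 (\<gamma> k) \<delta>)" for I
      by (induction I rule: infinite_finite_induct) auto
    from this[of UNIV] show ?thesis by (simp add: a(1)[symmetric])
  qed
  obtain k0 where k0: "a k0 > 0"
  proof -
    have "\<exists>k. a k \<noteq> 0" using \<delta>0 a(1) by (metis (no_types, lifting) scaleR_zero_left sum.neutral)
    then show ?thesis using a(2) that by (metis less_eq_real_def)
  qed
  have "L \<noteq> {}"
  proof
    assume "L = {}"
    then have "(\<Sum>k\<in>UNIV. a k * det2 (\<gamma> k) \<delta>) < (\<Sum>k\<in>(UNIV :: 'm set). 0)"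
      using a(2) C k0
      by (intro sum_strict_mono_ex1 ballI bexI[of _ k0])
        (simp_all add: mult_nonneg_nonpos less_imp_le mult_pos_neg)
    with sum0 show False by simp
  qed
  then obtain i0 where i0: "i0 \<in> L" by blast
  have "L \<noteq> UNIV"
  proof
    assume "L = UNIV"
    then have "(\<Sum>k\<in>(UNIV :: 'm set). 0) < (\<Sum>k\<in>UNIV. a k * det2 (\<gamma> k) \<delta>)"
      using a(2) L k0
      by (intro sum_strict_mono_ex1 ballI bexI[of _ k0]) (simp_all add: less_imp_le)
    with sum0 show False by simp
  qed
  then obtain j0 where j0: "j0 \<notin> L" by blast
  have pointed': "\<forall>c. (\<forall>k. 0 \<le> c k) \<longrightarrow> (\<Sum>k\<in>UNIV. c k *\<^sub>R \<gamma> k) = 0 \<longrightarrow> (\<forall>k. c k = 0)"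
    using pointed by blast
  have pair: "det2 (\<gamma> i) (\<gamma> j) > 0" "det2 (\<gamma> k) (\<gamma> j) / det2 (\<gamma> i) (\<gamma> j) \<in> \<int>"
    "det2 (\<gamma> i) (\<gamma> k) / det2 (\<gamma> i) (\<gamma> j) \<in> \<int>" if "i \<in> L" "j \<notin> L" for i j k
    using two_sided_pair[OF emb a(1) a(2) pointed' L[OF that(1)] C[OF that(2)]] by auto
  \<comment> \<open>In the basis \<gamma> i, \<gamma> j the primed pair has an integral matrix of
    positive determinant, hence of determinant at least 1. Exchanging the pairs gives
    equality.\<close>
  have le: "det2 (\<gamma> i) (\<gamma> j) \<le> det2 (\<gamma> i') (\<gamma> j')"
    if "i \<in> L" "j \<notin> L" "i' \<in> L" "j' \<notin> L" for i j i' j'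
  proof -
    define D where "D = det2 (\<gamma> i) (\<gamma> j)"
    define x y z w where "x = det2 (\<gamma> i') (\<gamma> j) / D" and "y = det2 (\<gamma> i) (\<gamma> i') / D"
      and "z = det2 (\<gamma> j') (\<gamma> j) / D" and "w = det2 (\<gamma> i) (\<gamma> j') / D"
    have D: "D > 0" using pair(1) that by (simp add: D_def)
    have ints: "x \<in> \<int>" "y \<in> \<int>" "z \<in> \<int>" "w \<in> \<int>"
      using pair(2,3) that by (auto simp: x_def y_def z_def w_def D_def)
    have e: "\<gamma> i' = x *\<^sub>R \<gamma> i + y *\<^sub>R \<gamma> j" "\<gamma> j' = z *\<^sub>R \<gamma> i + w *\<^sub>R \<gamma> j"
      unfolding x_def y_def z_def w_def D_def
      using D by (intro det2_expand; simp add: D_def)+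
    have "det2 (\<gamma> i') (\<gamma> j') = (x * w - y * z) * D"
      unfolding e by (simp add: det2_swap[of "\<gamma> j" "\<gamma> i"] D_def[symmetric] algebra_simps)
    moreover have "det2 (\<gamma> i') (\<gamma> j') > 0" using pair(1) that by simp
    ultimately have "x * w - y * z > 0" using D by (simp add: zero_less_mult_iff)
    moreover have "x * w - y * z \<in> \<int>" using ints by simp
    ultimately have "x * w - y * z \<ge> 1"
      by (auto elim!: Ints_cases)
    then show ?thesis
      using D \<open>det2 (\<gamma> i') (\<gamma> j') = (x * w - y * z) * D\<close>
        mult_right_mono[of 1 "x * w - y * z" D] by (simp add: D_def)
  qed
  define g h D where "g = \<gamma> i0" and "h = \<gamma> j0" and "D = det2 (\<gamma> i0) (\<gamma> j0)"
  have D: "D > 0" using pair(1) i0 j0 by (simp add: D_def)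
  have gh: "det2 g h = D" "det2 h g = - D"
    by (simp_all add: g_def h_def D_def det2_swap[of "\<gamma> j0"])
  have eqD: "det2 (\<gamma> i) (\<gamma> j) = D" if "i \<in> L" "j \<notin> L" for i j
    using le[OF that i0 j0] le[OF i0 j0 that] by (simp add: D_def)
  \<comment> \<open>The quotients are already integers by \<open>pair\<close>; the floor only
    changes their type.\<close>
  define b where "b k = \<lfloor>det2 g (\<gamma> k) / D\<rfloor>" for k
  define c where "c k = \<lfloor>det2 (\<gamma> k) h / D\<rfloor>" for k
  have b: "of_int (b k) = det2 g (\<gamma> k) / D" for k
    using pair(3)[OF i0 j0, of k] by (auto simp: b_def g_def h_def D_def elim: Ints_cases)
  have c: "of_int (c k) = det2 (\<gamma> k) h / D" for k
    using pair(2)[OF i0 j0, of k] by (auto simp: c_def g_def h_def D_def elim: Ints_cases)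
  have expand: "x = (det2 x h / D) *\<^sub>R g + (det2 g x / D) *\<^sub>R h" for x
    using det2_expand[of g h x] D by (simp add: gh)
  have \<gamma>L: "\<gamma> k = g + of_int (b k) *\<^sub>R h" if "k \<in> L" for k
    using expand[of "\<gamma> k"] eqD[OF that j0] D by (simp add: b h_def)
  have \<gamma>C: "\<gamma> k = h + of_int (c k) *\<^sub>R g" if "k \<notin> L" for k
    using expand[of "\<gamma> k"] eqD[OF i0 that] D by (simp add: c g_def add.commute)
  have prod0: "c j = 0 \<or> b i = 0" if "i \<in> L" "j \<notin> L" for i j
  proof -
    have "D = (1 - of_int (b i) * of_int (c j)) * D"
      using eqD[OF that] unfolding \<gamma>L[OF that(1)] \<gamma>C[OF that(2)]
      by (simp add: gh algebra_simps)
    then have "real_of_int (b i * c j) = 0" using D by (simp add: algebra_simps)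
    then show ?thesis by (simp only: of_int_eq_0_iff) auto
  qed
  define d where "d = det2 \<delta> h / D"
  define e where "e = det2 g \<delta> / D"
  have \<delta>: "\<delta> = d *\<^sub>R g + e *\<^sub>R h" unfolding d_def e_def by (rule expand)
  have de: "d > 0" "e > 0"
    using L[OF i0] C[OF j0] D det2_swap[of "\<gamma> j0" \<delta>]
    by (simp_all add: d_def e_def g_def h_def zero_less_divide_iff divide_less_0_iff)
  \<comment> \<open>The inequality is the sign of \<open>det2 (\<gamma> k) \<delta>\<close>, by
    which \<open>L\<close> was defined.\<close>
  have bd: "of_int (b k) * d < e" if "k \<in> L" for k
  proof -
    have "det2 (\<gamma> k) \<delta> = (e - of_int (b k) * d) * D"
      unfolding \<gamma>L[OF that] by (subst \<delta>) (simp add: gh algebra_simps)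
    with L[OF that] D show ?thesis by (simp add: zero_less_mult_iff)
  qed
  have ce: "of_int (c k) * e < d" if "k \<notin> L" for k
  proof -
    have "det2 (\<gamma> k) \<delta> = (of_int (c k) * e - d) * D"
      unfolding \<gamma>C[OF that] by (subst \<delta>) (simp add: gh algebra_simps)
    with C[OF that] D show ?thesis by (simp add: mult_less_0_iff)
  qed
  show ?thesis
  proof (cases "\<forall>j. j \<notin> L \<longrightarrow> c j = 0")
    case True
    have "split_system L g h b d e \<gamma> \<delta>"
      unfolding split_system_def
      using \<open>L \<noteq> {}\<close> \<open>L \<noteq> UNIV\<close> D gh \<delta> de bd \<gamma>L \<gamma>C True by auto
    then show ?thesis by (rule that)
  next
    case False
    then have "b i = 0" if "i \<in> L" for i using prod0 that by blast
    \<comment> \<open>The mirrored case: the groups, the basis vectors and the coefficients of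
      \<delta> are all exchanged, and the determinant becomes - D.\<close>
    then have "split_system (- L) h g c e d \<gamma> \<delta>"
      unfolding split_system_def
      using \<open>L \<noteq> {}\<close> \<open>L \<noteq> UNIV\<close> D gh \<delta> de ce \<gamma>L \<gamma>C by (auto simp: add.commute)
    then show ?thesis by (rule that)
  qed
qed

section \<open>Split systems give embeddings\<close>

text \<open>The squares sum to d on \<open>L\<close> and to e minus an average below e outside, both
  positive. The resulting coordinates are the ones whose phases determine \<phi> up to the
  half-lattice.\<close>

lemma split_system_point:
  assumes S: "split_system L g h b d e \<gamma> \<delta>" and u: "u \<in> Rset \<gamma> \<delta>"
  obtains i j where "i \<in> L" "j \<notin> L" "u $ i \<noteq> 0" "u $ j \<noteq> 0"
proof -
  have d: "0 < d" using S by (simp add: split_system_def)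
  have R: "(\<Sum>k\<in>L. (u $ k)\<^sup>2) = d"
    "(\<Sum>k\<in>L. of_int (b k) * (u $ k)\<^sup>2) + (\<Sum>k\<in>-L. (u $ k)\<^sup>2) = e"
    using Rset_split_system[OF S] u by auto
  have "(\<Sum>k\<in>L. of_int (b k) * (u $ k)\<^sup>2) < e" by (rule rescale_positive(2)[OF S S u])
  with R have "(\<Sum>k\<in>L. (u $ k)\<^sup>2) \<noteq> 0" "(\<Sum>k\<in>-L. (u $ k)\<^sup>2) \<noteq> 0" using d by auto
  then obtain i j where "i \<in> L" "(u $ i)\<^sup>2 \<noteq> 0" "j \<in> -L" "(u $ j)\<^sup>2 \<noteq> 0"
    by (metis (no_types, lifting) sum.not_neutral_contains_not_neutral)
  then show ?thesis using that by auto
qed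

text \<open>One vector from each group is already a basis of the lattice.\<close>

lemma split_system_Lstar_pair:
  assumes S: "split_system L g h b d e \<gamma> \<delta>" and ij: "i \<in> L" "j \<notin> L"
    and l: "\<gamma> i \<bullet> l \<in> \<int>" "\<gamma> j \<bullet> l \<in> \<int>"
  shows "l \<in> Lstar \<gamma>"
proof -
  have "\<gamma> i = g + of_int (b i) *\<^sub>R h" "\<gamma> j = h" using S ij by (auto simp: split_system_def)
  then have h: "h \<bullet> l \<in> \<int>" and "g \<bullet> l + of_int (b i) * (h \<bullet> l) \<in> \<int>"
    using l by (simp_all add: inner_add_left)
  then have "(g \<bullet> l + of_int (b i) * (h \<bullet> l)) - of_int (b i) * (h \<bullet> l) \<in> \<int>"
    by (intro Ints_diff Ints_mult) auto
  with h show ?thesis by (simp add: Lstar_split_system[OF S])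
qed

text \<open>For i in \<open>L\<close> and j outside, \<delta> = d \<gamma> i + (e - b i d) \<gamma>
  j with positive coefficients. No single ray contains \<delta>, because
  \<open>det2 (\<gamma> k) \<delta>\<close> is \<open>det2 g h\<close> times e - b k d or times - d.
  The lattice has basis g, h.\<close>

lemma split_system_quad_conditions:
  assumes S: "split_system L g h b d e \<gamma> \<delta>"
  shows "quad_conditions \<gamma> \<delta>"
proof -
  have D: "det2 g h \<noteq> 0" and \<gamma>: "\<And>k. \<gamma> k = (if k \<in> L then g + of_int (b k) *\<^sub>R h else h)"
    and \<delta>: "\<delta> = d *\<^sub>R g + e *\<^sub>R h" and d: "d > 0" and e: "\<And>k. k \<in> L \<Longrightarrow> of_int (b k) * d < e"
    using S by (auto simp: split_system_def)
  obtain i j where ij: "i \<in> L" "j \<notin> L" using S by (auto simp: split_system_def)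
  then have "i \<noteq> j" by blast
  note two = sum_scaleR_pair[OF this, of _ _ \<gamma>]
  have "\<delta> \<in> cone_gen \<gamma> UNIV"
    unfolding cone_gen_def
  proof (intro CollectI exI conjI ballI)
    show "\<delta> = (\<Sum>k\<in>UNIV. (if k = i then d else if k = j then e - of_int (b i) * d else 0) *\<^sub>R \<gamma> k)"
      unfolding two using ij by (simp add: \<gamma> \<delta> algebra_simps)
  qed (use d e[OF ij(1)] in auto)
  moreover have "card I \<ge> 2" if I: "\<delta> \<in> cone_gen \<gamma> I" for I
  proof (rule ccontr)
    assume "\<not> card I \<ge> 2"
    then consider "card I = 0" | "card I = 1" by linarith
    then show False
    proof cases
      case 1
      then have "\<delta> = 0" using I by (auto simp: cone_gen_def)
      then have "det2 \<delta> h = 0" by simp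
      then show False using D d by (simp add: \<delta>)
    next
      case 2
      then obtain k where "I = {k}" by (auto simp: card_1_singleton_iff)
      then obtain a where "\<delta> = a *\<^sub>R \<gamma> k" using I by (auto simp: cone_gen_def)
      then have "det2 (\<gamma> k) \<delta> = 0" by simp
      moreover have "det2 (\<gamma> k) \<delta> = (if k \<in> L then (e - of_int (b k) * d) * det2 g h else - (d * det2 g h))"
        by (simp add: \<gamma> \<delta> det2_swap[of h g] algebra_simps)
      ultimately show False using D d e[of k] by (auto split: if_splits)
    qed
  qed
  moreover have "\<exists>b1 b2. b1 \<noteq> b2 \<and> independent {b1, b2} \<and>
        int_lattice \<gamma> = {a *\<^sub>R b1 + c *\<^sub>R b2 | a c. a \<in> \<int> \<and> c \<in> \<int>}"
  proof (intro exI conjI)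
    show "g \<noteq> h" using D by auto
    show "independent {g, h}"
    proof -
      have "x = 0 \<and> y = 0" if "x *\<^sub>R g + y *\<^sub>R h = 0" for x y
      proof -
        have "det2 (x *\<^sub>R g + y *\<^sub>R h) h = 0" "det2 g (x *\<^sub>R g + y *\<^sub>R h) = 0"
          by (simp_all only: that det2_simps)
        then show ?thesis using D by simp
      qed
      with \<open>g \<noteq> h\<close> show ?thesis by (subst independent_explicit) auto
    qed
    show "int_lattice \<gamma> = {a *\<^sub>R g + c *\<^sub>R h | a c. a \<in> \<int> \<and> c \<in> \<int>}"
    proof (intro equalityI subsetI)
      fix x assume "x \<in> int_lattice \<gamma>"
      then obtain c where c: "x = (\<Sum>k\<in>UNIV. c k *\<^sub>R \<gamma> k)" "\<And>k. c k \<in> \<int>"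
        by (auto simp: int_lattice_def)
      have "x = (\<Sum>k\<in>UNIV. (if k \<in> L then c k else 0) *\<^sub>R g + (if k \<in> L then c k * of_int (b k) else c k) *\<^sub>R h)"
        unfolding c(1) by (rule sum.cong) (auto simp: \<gamma> scaleR_add_right)
      then have "x = (\<Sum>k\<in>UNIV. if k \<in> L then c k else 0) *\<^sub>R g +
          (\<Sum>k\<in>UNIV. if k \<in> L then c k * of_int (b k) else c k) *\<^sub>R h"
        by (simp only: sum.distrib scaleR_sum_left)
      moreover have "(\<Sum>k\<in>UNIV. if k \<in> L then c k else 0) \<in> \<int>"
        "(\<Sum>k\<in>UNIV. if k \<in> L then c k * of_int (b k) else c k) \<in> \<int>"
        using c(2) by (auto intro!: Ints_sum)
      ultimately show "x \<in> {a *\<^sub>R g + c *\<^sub>R h | a c. a \<in> \<int> \<and> c \<in> \<int>}" by blast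
    next
      fix x assume "x \<in> {a *\<^sub>R g + c *\<^sub>R h | a c. a \<in> \<int> \<and> c \<in> \<int>}"
      then obtain a c where x: "x = a *\<^sub>R g + c *\<^sub>R h" and ac: "a \<in> \<int>" "c \<in> \<int>" by blast
      have "x = (\<Sum>k\<in>UNIV. (if k = i then a else if k = j then c - of_int (b i) * a else 0) *\<^sub>R \<gamma> k)"
        unfolding two using ij by (simp add: \<gamma> x algebra_simps)
      moreover have "(if k = i then a else if k = j then c - of_int (b i) * a else 0) \<in> \<int>" for k
        using ac by auto
      ultimately show "x \<in> int_lattice \<gamma>"
        unfolding int_lattice_def by (intro CollectI exI conjI allI)
    qed
  qed
  ultimately show ?thesis by (simp add: quad_conditions_def)
qed

text \<open>Each square on \<open>L\<close> is at most d, so the weighted sum in the second equation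
  is bounded below, and this bounds the squares outside \<open>L\<close>.\<close>

lemma split_system_compact:
  assumes S: "split_system L g h b d e \<gamma> \<delta>"
  shows "compact (Rset \<gamma> \<delta>)"
proof -
  have "closed (Rset \<gamma> \<delta>)"
    unfolding Rset_def by (intro closed_Collect_all closed_Collect_eq continuous_intros)
  moreover have "bounded (Rset \<gamma> \<delta>)"
  proof -
    define M where "M = d + (e + (\<Sum>k\<in>L. \<bar>of_int (b k)\<bar> * d))"
    have "norm u \<le> sqrt M" if u: "u \<in> Rset \<gamma> \<delta>" for u
    proof -
      have R: "(\<Sum>k\<in>L. (u $ k)\<^sup>2) = d"
        "(\<Sum>k\<in>L. of_int (b k) * (u $ k)\<^sup>2) + (\<Sum>k\<in>-L. (u $ k)\<^sup>2) = e"
        using Rset_split_system[OF S] u by auto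
      have le: "(u $ k)\<^sup>2 \<le> d" if "k \<in> L" for k
        unfolding R(1)[symmetric] using that by (intro member_le_sum) auto
      have "- (\<Sum>k\<in>L. of_int (b k) * (u $ k)\<^sup>2) = (\<Sum>k\<in>L. - of_int (b k) * (u $ k)\<^sup>2)"
        by (simp add: sum_negf)
      also have "\<dots> \<le> (\<Sum>k\<in>L. \<bar>of_int (b k)\<bar> * d)"
        by (intro sum_mono mult_mono le) auto
      finally have "(\<Sum>k\<in>-L. (u $ k)\<^sup>2) \<le> e + (\<Sum>k\<in>L. \<bar>of_int (b k)\<bar> * d)"
        using R(2) by linarith
      moreover have "(\<Sum>k\<in>UNIV. (u $ k)\<^sup>2) = (\<Sum>k\<in>L. (u $ k)\<^sup>2) + (\<Sum>k\<in>-L. (u $ k)\<^sup>2)"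
        by (subst sum.union_disjoint[symmetric]) (auto simp: Compl_partition)
      ultimately have "(\<Sum>k\<in>UNIV. (u $ k)\<^sup>2) \<le> M" using R(1) by (simp add: M_def)
      then show ?thesis by (simp add: norm_vec_def L2_set_def)
    qed
    then show ?thesis by (auto simp: bounded_iff)
  qed
  ultimately show ?thesis by (simp add: compact_eq_bounded_closed)
qed

section \<open>Local inverses of the map i\<close>

lemma cis_mult_real_eq:
  assumes "cis s * complex_of_real a = cis t * complex_of_real c"
  shows "c = cos (s - t) * a" "sin (s - t) * a = 0"
proof -
  have "cis (s - t) * complex_of_real a = cis (- t) * (cis s * complex_of_real a)"
    by (simp add: cis_mult mult.assoc[symmetric])
  also have "\<dots> = complex_of_real c"
    by (simp add: assms cis_mult mult.assoc[symmetric])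
  finally show "c = cos (s - t) * a" "sin (s - t) * a = 0"
    by (auto simp: complex_eq_iff)
qed

lemma Re_cis_mult: "Re (cis (- t) * z) = cos t * Re z + sin t * Im z"
  by simp

lemma Cinf_on_Re_nth: "Cinf_on U (\<lambda>z::complex^'m. Re (z $ k))"
  and Cinf_on_Im_nth: "Cinf_on U (\<lambda>z::complex^'m. Im (z $ k))"
  by (intro Cinf_on_bounded_linear bounded_linear_compose[OF bounded_linear_Re bounded_linear_vec_nth]
      bounded_linear_compose[OF bounded_linear_Im bounded_linear_vec_nth])+

lemma smooth_map_on_i_map: "smooth_map_on S (i_map \<gamma>)"
proof (rule smooth_map_on_complex_vecI)
  fix k
  have "Cinf_on UNIV (\<lambda>x. cos (2 * pi * (\<gamma> k \<bullet> snd x)) * fst x $ k)"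
    "Cinf_on UNIV (\<lambda>x. sin (2 * pi * (\<gamma> k \<bullet> snd x)) * fst x $ k)"
    by (intro Cinf_on_mult Cinf_on_cos Cinf_on_sin Cinf_on_const Cinf_on_inner_snd Cinf_on_fst_nth)+
  then show "smooth_on S (\<lambda>x. Re (i_map \<gamma> x $ k))" "smooth_on S (\<lambda>x. Im (i_map \<gamma> x $ k))"
    by (auto simp: i_map_def intro: Cinf_on_imp_smooth_on)
qed

text \<open>A branch of the argument on the half plane around \<open>c\<close>.\<close>

definition local_arg :: "complex \<Rightarrow> complex \<Rightarrow> real" where
  "local_arg c w = Arg c + arctan (Im (w * cnj c) / Re (w * cnj c))"

text \<open>On this half plane the arctangent is the principal argument of w times the conjugate of
  c, so adding \<open>Arg c\<close> gives an argument of w. Only the constant c enters through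
  \<open>Arg\<close>, so no branch cut is met.\<close>

lemma cis_local_arg:
  assumes "Re (w * cnj c) > 0"
  shows "cis (local_arg c w) * complex_of_real (cmod w) = w"
proof -
  have nz: "c \<noteq> 0" "w \<noteq> 0" using assms by auto
  have "arctan (Im (w * cnj c) / Re (w * cnj c)) = Arg (w * cnj c)"
    using assms by (rule arg_conv_arctan[symmetric])
  then have "cis (local_arg c w) = cis (Arg c) * cis (Arg (w * cnj c))"
    by (simp add: local_arg_def cis_mult)
  also have "\<dots> = sgn c * sgn (w * cnj c)" using nz by (simp add: cis_Arg)
  also have "\<dots> * complex_of_real (cmod w) = w"
  proof -
    have "c * cnj c = (complex_of_real (cmod c))\<^sup>2" by (simp add: complex_norm_square[symmetric])
    then show ?thesis using nz
      by (simp add: sgn_eq norm_mult field_simps power2_eq_square)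
  qed
  finally show ?thesis .
qed

lemma Cinf_on_local_arg:
  assumes "\<And>z. z \<in> U \<Longrightarrow> Re (z $ k * cnj c) > 0"
  shows "Cinf_on U (\<lambda>z::complex^'m. local_arg c (z $ k))"
proof -
  have "Re (z $ k) * Re c + Im (z $ k) * Im c \<noteq> 0" if "z \<in> U" for z
    using assms[OF that] by simp
  then show ?thesis
    unfolding local_arg_def
    by (auto intro!: Cinf_intros Cinf_on_Re_nth Cinf_on_Im_nth)
qed

text \<open>Near i(x0) the arguments of two nonzero coordinates, one in each group, determine
  \<phi>, and undoing the phases of \<phi> gives u. Since coordinates of u may be negative, these
  arguments are known only up to multiples of pi, so x is recovered up to \<open>N_rel\<close>,
  which is all that is needed.\<close>

lemma i_map_local_section:
  assumes S: "split_system L g h b d e \<gamma> \<delta>" and x0: "x0 \<in> Mset \<gamma> \<delta>"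
  obtains V \<sigma> where "open V" "i_map \<gamma> x0 \<in> V" "smooth_map_on V \<sigma>"
    "\<And>x. i_map \<gamma> x \<in> V \<Longrightarrow> N_rel \<gamma> x (\<sigma> (i_map \<gamma> x))"
proof -
  have "fst x0 \<in> Rset \<gamma> \<delta>" using x0 by (auto simp: Mset_def)
  then obtain i j where ij: "i \<in> L" "j \<notin> L" "fst x0 $ i \<noteq> 0" "fst x0 $ j \<noteq> 0"
    using split_system_point[OF S] by blast
  have D: "det2 g h \<noteq> 0" and \<gamma>: "\<gamma> i = g + of_int (b i) *\<^sub>R h" "\<gamma> j = h"
    using S ij by (auto simp: split_system_def)
  define c where "c = i_map \<gamma> x0"
  have c: "c $ i \<noteq> 0" "c $ j \<noteq> 0" using ij by (simp_all add: c_def i_map_def)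
  define V where "V = {z. Re (z $ i * cnj (c $ i)) > 0} \<inter> {z. Re (z $ j * cnj (c $ j)) > 0}"
  define \<theta> where "\<theta> k z = local_arg (c $ k) (z $ k) / (2 * pi)" for k and z :: "complex^'a"
  \<comment> \<open>Solves \<gamma> i \<bullet> \<phi> = \<theta> i and \<gamma> j \<bullet> \<phi>
    = \<theta> j, using that \<gamma> i is g plus b i times \<gamma> j.\<close>
  define \<phi> where "\<phi> z = dual2 g h (\<theta> i z - of_int (b i) * \<theta> j z) (\<theta> j z)" for z
  \<comment> \<open>On the image of the cover the untwisted coordinates are real; the real part
    extends the formula smoothly to all of V.\<close>
  define \<sigma> where "\<sigma> z = ((\<chi> k. Re (cis (- (2 * pi * (\<gamma> k \<bullet> \<phi> z))) * z $ k)), \<phi> z)" for z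
  have "open V" unfolding V_def
    by (intro open_Int open_Collect_less continuous_intros)
  moreover have "i_map \<gamma> x0 \<in> V"
    using c by (auto simp: V_def c_def[symmetric] complex_neq_0 power2_eq_square[symmetric])
  moreover have "smooth_map_on V \<sigma>"
  proof -
    have \<theta>: "Cinf_on V (\<theta> i)" "Cinf_on V (\<theta> j)"
      unfolding \<theta>_def
      by (rule Cinf_on_divide[OF Cinf_on_local_arg Cinf_on_const], simp_all add: V_def)+
    have \<phi>: "Cinf_on V (\<lambda>z. \<phi> z $ n)" for n
      using exhaust_2[of n] D by (auto simp: \<phi>_def intro!: Cinf_intros \<theta>)
    have \<gamma>\<phi>: "Cinf_on V (\<lambda>z. 2 * pi * (\<gamma> k \<bullet> \<phi> z))" for k
      unfolding inner_vec2 by (intro Cinf_intros \<phi>)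
    show ?thesis
    proof (rule smooth_map_on_prodI)
      fix k
      have "Cinf_on V (\<lambda>z. fst (\<sigma> z) $ k)"
        unfolding \<sigma>_def fst_conv vec_lambda_beta Re_cis_mult
        by (intro Cinf_intros \<gamma>\<phi> Cinf_on_Re_nth Cinf_on_Im_nth)
      then show "smooth_on V (\<lambda>z. fst (\<sigma> z) $ k)"
        by (rule Cinf_on_imp_smooth_on[OF _ \<open>open V\<close>]) simp
    next
      fix n
      have "Cinf_on V (\<lambda>z. snd (\<sigma> z) $ n)" unfolding \<sigma>_def snd_conv by (rule \<phi>)
      then show "smooth_on V (\<lambda>z. snd (\<sigma> z) $ n)"
        by (rule Cinf_on_imp_smooth_on[OF _ \<open>open V\<close>]) simp
    qed
  qed
  moreover have "N_rel \<gamma> x (\<sigma> (i_map \<gamma> x))" if xV: "i_map \<gamma> x \<in> V" for x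
  proof -
    define z where "z = i_map \<gamma> x"
    have z: "z $ k = cis (2 * pi * (\<gamma> k \<bullet> snd x)) * complex_of_real (fst x $ k)" for k
      by (simp add: z_def i_map_def)
    \<comment> \<open>At i and j both descriptions of the coordinate of z are a phase times a
      nonzero real, so the angles differ by a multiple of pi. Doubling the difference of the \<phi>
      values therefore gives integral pairings.\<close>
    define l where "l = 2 *\<^sub>R (\<phi> z - snd x)"
    have angle: "2 * pi * (\<gamma> k \<bullet> snd x) - 2 * pi * (\<gamma> k \<bullet> \<phi> z) = - (pi * (\<gamma> k \<bullet> l))" for k
      by (simp add: l_def inner_diff_right algebra_simps)
    have "\<gamma> i \<bullet> \<phi> z = \<theta> i z" "\<gamma> j \<bullet> \<phi> z = \<theta> j z"
      using D by (simp_all add: \<gamma> \<phi>_def inner_add_left inner_dual2)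
    moreover have "Re (z $ i * cnj (c $ i)) > 0" "Re (z $ j * cnj (c $ j)) > 0"
      using xV by (auto simp: V_def z_def)
    ultimately have ph: "cis (2 * pi * (\<gamma> k \<bullet> \<phi> z)) * complex_of_real (cmod (z $ k)) = z $ k"
      and nz: "z $ k \<noteq> 0" if "k = i \<or> k = j" for k
      using that cis_local_arg by (auto simp: \<theta>_def)
    have "\<gamma> k \<bullet> l \<in> \<int>" if k: "k = i \<or> k = j" for k
    proof -
      have "sin (- (pi * (\<gamma> k \<bullet> l))) * fst x $ k = 0"
        using cis_mult_real_eq(2)[OF trans[OF z[symmetric] ph[OF k, symmetric]]] by (simp only: angle)
      moreover have "fst x $ k \<noteq> 0" using nz[OF k] by (auto simp: z)
      ultimately show ?thesis by (simp add: sin_pi_eq_0_iff)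
    qed
    then have l: "l \<in> Lstar \<gamma>" using split_system_Lstar_pair[OF S ij(1,2)] by blast
    have "Re (cis (- (2 * pi * (\<gamma> k \<bullet> \<phi> z))) * z $ k) = cos (pi * (\<gamma> k \<bullet> l)) * fst x $ k" for k
    proof -
      have "cis (- (2 * pi * (\<gamma> k \<bullet> \<phi> z))) * z $ k =
          cis (2 * pi * (\<gamma> k \<bullet> snd x) - 2 * pi * (\<gamma> k \<bullet> \<phi> z)) * complex_of_real (fst x $ k)"
        by (simp add: z cis_mult mult.assoc[symmetric])
      then show ?thesis by (simp add: angle)
    qed
    then have "N_rel \<gamma> x (\<sigma> z)"
      unfolding N_rel_def by (intro bexI[OF _ l]) (auto simp: \<sigma>_def l_def)
    then show ?thesis by (simp add: z_def)
  qed
  ultimately show ?thesis by (rule that)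
qed

lemma N_rel_Mset:
  assumes "N_rel \<gamma> x y" "x \<in> Mset \<gamma> \<delta>" shows "y \<in> Mset \<gamma> \<delta>"
  using assms(2) N_rel_square[OF assms(1)] by (cases x; cases y) (auto simp: Mset_def Rset_def)

lemma split_system_embedding:
  assumes S: "split_system L g h b d e \<gamma> \<delta>"
  shows "N_embedding \<gamma> \<delta>"
proof -
  have inj: "N_rel \<gamma> x y" if x: "x \<in> Mset \<gamma> \<delta>" and eq: "i_map \<gamma> x = i_map \<gamma> y" for x y
  proof -
    define l where "l = 2 *\<^sub>R (snd y - snd x)"
    have angle: "2 * pi * (\<gamma> k \<bullet> snd x) - 2 * pi * (\<gamma> k \<bullet> snd y) = - (pi * (\<gamma> k \<bullet> l))" for k
      by (simp add: l_def inner_diff_right algebra_simps)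
    have "cis (2 * pi * (\<gamma> k \<bullet> snd x)) * complex_of_real (fst x $ k) =
        cis (2 * pi * (\<gamma> k \<bullet> snd y)) * complex_of_real (fst y $ k)" for k
      using eq by (simp add: i_map_def vec_eq_iff)
    from cis_mult_real_eq[OF this]
    have k: "fst y $ k = cos (pi * (\<gamma> k \<bullet> l)) * fst x $ k" "sin (pi * (\<gamma> k \<bullet> l)) * fst x $ k = 0" for k
      by (simp_all add: angle)
    have "fst x \<in> Rset \<gamma> \<delta>" using x by (auto simp: Mset_def)
    then obtain i j where ij: "i \<in> L" "j \<notin> L" "fst x $ i \<noteq> 0" "fst x $ j \<noteq> 0"
      using split_system_point[OF S] by blast
    have "\<gamma> i \<bullet> l \<in> \<int>" "\<gamma> j \<bullet> l \<in> \<int>" using k(2) ij by (auto simp flip: sin_pi_eq_0_iff)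
    then have "l \<in> Lstar \<gamma>" by (rule split_system_Lstar_pair[OF S ij(1,2)])
    then show ?thesis unfolding N_rel_def by (rule bexI[rotated]) (auto simp: k(1) l_def)
  qed
  have pull: "\<exists>G. smooth_on (i_map \<gamma> ` Mset \<gamma> \<delta>) G \<and> (\<forall>x\<in>Mset \<gamma> \<delta>. f x = G (i_map \<gamma> x))"
    if f: "N_smooth_fun \<gamma> \<delta> f" for f
  proof -
    have finv: "f x = f y" if "x \<in> Mset \<gamma> \<delta>" "N_rel \<gamma> x y" for x y
      using f that N_rel_Mset[OF that(2,1)] by (auto simp: N_smooth_fun_def N_invariant_def)
    \<comment> \<open>An arbitrary preimage is chosen; two preimages are related by injectivity and
      f is constant on classes, so the choice does not affect the value.\<close>
    define G where "G z = f (SOME x. x \<in> Mset \<gamma> \<delta> \<and> i_map \<gamma> x = z)" for z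
    have G: "G (i_map \<gamma> x) = f x" if x: "x \<in> Mset \<gamma> \<delta>" for x
    proof -
      define y where "y = (SOME y. y \<in> Mset \<gamma> \<delta> \<and> i_map \<gamma> y = i_map \<gamma> x)"
      have "y \<in> Mset \<gamma> \<delta> \<and> i_map \<gamma> y = i_map \<gamma> x"
        unfolding y_def by (rule someI[of _ x]) (simp add: x)
      then have "f y = f x" using inj finv by blast
      then show ?thesis by (simp add: G_def y_def)
    qed
    have "smooth_on (i_map \<gamma> ` Mset \<gamma> \<delta>) G"
    proof (rule smooth_on_local)
      fix z assume "z \<in> i_map \<gamma> ` Mset \<gamma> \<delta>"
      then obtain x0 where x0: "x0 \<in> Mset \<gamma> \<delta>" "z = i_map \<gamma> x0" by blast
      obtain V \<sigma> where V: "open V" "i_map \<gamma> x0 \<in> V" "smooth_map_on V \<sigma>"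
        and \<sigma>: "\<And>x. i_map \<gamma> x \<in> V \<Longrightarrow> N_rel \<gamma> x (\<sigma> (i_map \<gamma> x))"
        using i_map_local_section[OF S x0(1)] by metis
      have "smooth_on (i_map \<gamma> ` Mset \<gamma> \<delta> \<inter> V) (\<lambda>z. f (\<sigma> z))"
      proof (rule smooth_on_compose[where h = f and F = \<sigma>])
        show "smooth_on (Mset \<gamma> \<delta>) f" using f by (simp add: N_smooth_fun_def)
        show "smooth_map_on (i_map \<gamma> ` Mset \<gamma> \<delta> \<inter> V) \<sigma>"
          by (rule smooth_map_on_subset[OF V(3)]) auto
        show "\<sigma> ` (i_map \<gamma> ` Mset \<gamma> \<delta> \<inter> V) \<subseteq> Mset \<gamma> \<delta>"
          using N_rel_Mset[OF \<sigma>] by auto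
      qed
      \<comment> \<open>On the image, \<sigma> z is related to every preimage of z in the cover, so
        f after \<sigma> agrees with G.\<close>
      then have "smooth_on (i_map \<gamma> ` Mset \<gamma> \<delta> \<inter> V) G"
        by (rule smooth_on_cong) (use finv \<sigma> G in fastforce)
      then show "\<exists>V. open V \<and> z \<in> V \<and> smooth_on (i_map \<gamma> ` Mset \<gamma> \<delta> \<inter> V) G"
        using V x0 by blast
    qed
    then show ?thesis using G by (intro exI[of _ G]) auto
  qed
  show ?thesis
    unfolding N_embedding_def using smooth_map_on_i_map inj pull by blast
qed

text \<open>The strict inequality b k d < e explains the constants 1 and 2 in
  \<open>Nk_delta\<close>: it holds for coefficients 0 and 1, whereas equal right-hand sides would
  violate it on A.\<close>

lemma Nk_split_system:
  assumes "A \<union> B \<union> C = UNIV" "A \<inter> B = {}" "A \<inter> C = {}" "B \<inter> C = {}" "A \<union> B \<noteq> {}" "C \<noteq> {}"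
  shows "split_system (A \<union> B) (vector [1, 0]) (vector [0, 1]) (\<lambda>k. if k \<in> A then 1 else 0) 1 2
    (Nk_gamma A B C) Nk_delta"
  using assms
  by (auto simp: split_system_def det2_def Nk_gamma_def Nk_delta_def vec_eq_iff forall_2)

lemma N_diffeomorphic_refl: "N_diffeomorphic \<gamma> \<delta> \<gamma> \<delta>"
  unfolding N_diffeomorphic_def by (rule exI[of _ id]) (auto intro: N_rel_refl)

lemma card_add_card_Compl: "card A + card (- A) = CARD('a)" for A :: "'a::finite set"
  using card_Un_disjoint[of A "- A"] by (simp add: Compl_partition)

theorem theorem12p13:
  fixes m :: nat
  assumes "m = CARD('m::finite)"
  shows
   "(\<forall>(\<gamma>::'m \<Rightarrow> real^2) \<delta>.
       quad_conditions \<gamma> \<delta> \<and> compact (Rset \<gamma> \<delta>) \<and> N_embedding \<gamma> \<delta> \<longrightarrow>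
       (\<exists>k p q. p + q = m \<and> 0 < p \<and> p < m \<and> k \<le> p \<and> diffeomorphic_to_Nkpq \<gamma> \<delta> k p q))
    \<and>
    (\<forall>k p q. p + q = m \<and> 0 < p \<and> p < m \<and> k \<le> p \<longrightarrow>
       (\<exists>(\<gamma>::'m \<Rightarrow> real^2) \<delta>.
          quad_conditions \<gamma> \<delta> \<and> compact (Rset \<gamma> \<delta>) \<and> N_embedding \<gamma> \<delta> \<and>
          diffeomorphic_to_Nkpq \<gamma> \<delta> k p q))"
proof (intro conjI allI impI; elim conjE)
  fix \<gamma> :: "'m \<Rightarrow> real^2" and \<delta>
  assume "quad_conditions \<gamma> \<delta>" "compact (Rset \<gamma> \<delta>)" "N_embedding \<gamma> \<delta>"
  then obtain L g h b d e where S: "split_system L g h b d e \<gamma> \<delta>"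
    by (rule embedding_imp_split_system)
  \<comment> \<open>Odd coefficients become 1 and even ones 0, which puts the coordinate into both
    model quadrics or only into the first. The triple is thus formed by the sizes of
    \<open>A\<close>, \<open>L\<close> and \<open>- L\<close>.\<close>
  define A where "A = {k \<in> L. odd (b k)}"
  have L: "L \<noteq> {}" "L \<noteq> UNIV" using S by (auto simp: split_system_def)
  have AL: "A \<subseteq> L" by (auto simp: A_def)
  then have U: "A \<union> (L - A) = L" by auto
  have card: "card L + card (- L) = m"
    by (simp add: assms card_add_card_Compl)
  have "card L > 0" using L by (simp add: card_gt_0_iff)
  moreover have "- L \<noteq> {}" using L by blast
  then have "card (- L) > 0" by (simp add: card_gt_0_iff)
  moreover have "card A \<le> card L" using AL by (simp add: card_mono)
  moreover have "diffeomorphic_to_Nkpq \<gamma> \<delta> (card A) (card L) (card (- L))"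
    unfolding diffeomorphic_to_Nkpq_def
  proof (rule exI[of _ A], rule exI[of _ "L - A"], rule exI[of _ "- L"], intro conjI)
    have "split_system L (vector [1, 0]) (vector [0, 1]) (\<lambda>k. if k \<in> A then 1 else 0) 1 2
      (Nk_gamma A (L - A) (- L)) Nk_delta"
      using Nk_split_system[of A "L - A" "- L"] AL L U by auto
    then show "N_diffeomorphic \<gamma> \<delta> (Nk_gamma A (L - A) (- L)) Nk_delta"
      by (rule N_diffeomorphic_split_system[OF S]) (auto simp: A_def)
    show "card (L - A) = card L - card A" using AL by (simp add: card_Diff_subset)
  qed (use AL in auto)
  ultimately have "card L + card (- L) = m \<and> 0 < card L \<and> card L < m \<and> card A \<le> card L \<and>
      diffeomorphic_to_Nkpq \<gamma> \<delta> (card A) (card L) (card (- L))"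
    using card by simp
  then show "\<exists>k p q. p + q = m \<and> 0 < p \<and> p < m \<and> k \<le> p \<and> diffeomorphic_to_Nkpq \<gamma> \<delta> k p q"
    by blast
next
  fix k p q
  assume pq: "p + q = m" "0 < p" "p < m" "k \<le> p"
  \<comment> \<open>The model system is its own witness: any nested coordinate sets of sizes k and p
    serve, and the diffeomorphism is the identity.\<close>
  obtain P :: "'m set" where P: "card P = p"
    using obtain_subset_with_card_n[of p "UNIV :: 'm set"] pq assms by auto
  obtain A where A: "A \<subseteq> P" "card A = k"
    using obtain_subset_with_card_n[of k P] pq P by auto
  have q: "card (- P) = q" using pq assms P card_add_card_Compl[of P] by simp
  have ne: "P \<noteq> {}" "- P \<noteq> {}" using P q pq by auto
  have S: "split_system (A \<union> (P - A)) (vector [1, 0]) (vector [0, 1]) (\<lambda>k. if k \<in> A then 1 else 0) 1 2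
      (Nk_gamma A (P - A) (- P)) Nk_delta"
    by (rule Nk_split_system) (use A ne in auto)
  have "diffeomorphic_to_Nkpq (Nk_gamma A (P - A) (- P)) Nk_delta k p q"
    unfolding diffeomorphic_to_Nkpq_def
  proof (rule exI[of _ A], rule exI[of _ "P - A"], rule exI[of _ "- P"], intro conjI N_diffeomorphic_refl)
    show "card (P - A) = p - k" using A P by (simp add: card_Diff_subset)
  qed (use A q in auto)
  then show "\<exists>(\<gamma>::'m \<Rightarrow> real^2) \<delta>.
          quad_conditions \<gamma> \<delta> \<and> compact (Rset \<gamma> \<delta>) \<and> N_embedding \<gamma> \<delta> \<and>
          diffeomorphic_to_Nkpq \<gamma> \<delta> k p q"
    using split_system_quad_conditions[OF S] split_system_compact[OF S] split_system_embedding[OF S]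
    by blast
qed

end
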